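(* Let $P$ be a principal ideal domain, let $r\in P\setminus\{0\}$ and let $R=P/rP$. Then $R$ is exact, and $$\operatorname{Row}(A)^\perp\cong R^{1\times n}/\operatorname{Row}(A)$$ as $R$-modules for all positive integers $m,n$ and all $A\in R^{m\times n}$.
   Context: A principal ideal domain is an integral domain (commutative, with $0\neq1$ and no zero divisors) in which every ideal is generated by a single element; fields are included. $R^{m\times n}$ is the set of $m\times n$ matrices over $R$. For $A\in R^{m\times n}$, $\operatorname{Row}(A)=\{uA: u\in R^{1\times m}\}\subseteq R^{1\times n}$ and $\operatorname{Col}(A)=\{Av: v\in R^{n\times 1}\}\subseteq R^{m\times 1}$. For $X\subseteq R^{1\times n}$, the orthogonal complement is $X^\perp=\{v\in R^{n\times 1}: xv=0\text{ for all }x\in X\}$. $R$ is exact if for all positive integers $m,n$ and all $A\in R^{m\times n}$: (E1) if $x\in R^{1\times n}\setminus\operatorname{Row}(A)$ then there are $v,v'\in R^{n\times 1}$ with $Av=Av'$ but $xv\neq xv'$; and (E2) if $y\in R^{m\times 1}\setminus\operatorname{Col}(A)$ then there are $u,u'\in R^{1\times m}$ with $uA=u'A$ but $uy\neq u'y$. Since $R$ is commutative, left and right $R$-modules are identified. *)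

theory Defs
  imports
    "HOL-Algebra.QuotRing"
    "HOL-Algebra.Ring_Divisibility"
    "HOL-Algebra.Module"
    "Jordan_Normal_Form.Matrix"
begin

text \<open>
  The type of matrices is the one of Jordan_Normal_Form, but its arithmetic belongs to type
  classes and cannot be used for a ring given by a record such as a quotient ring, so the
  operations are defined here relative to a record \<open>R\<close>.
  Row vectors are \<open>1 \<times> n\<close> matrices, column vectors are \<open>n \<times> 1\<close> matrices, and a scalar product
  \<open>xv\<close> is a \<open>1 \<times> 1\<close> matrix.
\<close>

definition mats :: "('a, 'b) ring_scheme \<Rightarrow> nat \<Rightarrow> nat \<Rightarrow> 'a mat set" where
  "mats R m n = {A \<in> carrier_mat m n. elements_mat A \<subseteq> carrier R}"

definition mat_mult :: "('a, 'b) ring_scheme \<Rightarrow> 'a mat \<Rightarrow> 'a mat \<Rightarrow> 'a mat" where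
  "mat_mult R A B = mat (dim_row A) (dim_col B)
     (\<lambda>(i, j). \<Oplus>\<^bsub>R\<^esub>k \<in> {..<dim_col A}. A $$ (i, k) \<otimes>\<^bsub>R\<^esub> B $$ (k, j))"

definition mat_zero :: "('a, 'b) ring_scheme \<Rightarrow> nat \<Rightarrow> nat \<Rightarrow> 'a mat" where
  "mat_zero R m n = mat m n (\<lambda>_. \<zero>\<^bsub>R\<^esub>)"

definition Row :: "('a, 'b) ring_scheme \<Rightarrow> 'a mat \<Rightarrow> 'a mat set" where
  "Row R A = {mat_mult R u A | u. u \<in> mats R 1 (dim_row A)}"

definition Col :: "('a, 'b) ring_scheme \<Rightarrow> 'a mat \<Rightarrow> 'a mat set" where
  "Col R A = {mat_mult R A v | v. v \<in> mats R (dim_col A) 1}"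

definition orth_compl :: "('a, 'b) ring_scheme \<Rightarrow> nat \<Rightarrow> 'a mat set \<Rightarrow> 'a mat set" where
  "orth_compl R n X = {v \<in> mats R n 1. \<forall>x \<in> X. mat_mult R x v = mat_zero R 1 1}"

definition exact_ring :: "('a, 'b) ring_scheme \<Rightarrow> bool" where
  "exact_ring R \<longleftrightarrow>
     (\<forall>m > 0. \<forall>n > 0. \<forall>A \<in> mats R m n.
        (\<forall>x \<in> mats R 1 n - Row R A. \<exists>v \<in> mats R n 1. \<exists>v' \<in> mats R n 1.
           mat_mult R A v = mat_mult R A v' \<and> mat_mult R x v \<noteq> mat_mult R x v') \<and>
        (\<forall>y \<in> mats R m 1 - Col R A. \<exists>u \<in> mats R 1 m. \<exists>u' \<in> mats R 1 m.
           mat_mult R u A = mat_mult R u' A \<and> mat_mult R u y \<noteq> mat_mult R u' y))"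

text \<open>
  Module records extend ring records; the fields \<open>mult\<close> and \<open>one\<close> play no role in a module.
\<close>

definition mat_module :: "('a, 'b) ring_scheme \<Rightarrow> nat \<Rightarrow> nat \<Rightarrow> ('a, 'a mat) module" where
  "mat_module R m n =
     \<lparr>carrier = mats R m n, mult = undefined, one = undefined,
      zero = mat_zero R m n,
      add = (\<lambda>A B. mat m n (\<lambda>ij. A $$ ij \<oplus>\<^bsub>R\<^esub> B $$ ij)),
      smult = (\<lambda>a A. mat m n (\<lambda>ij. a \<otimes>\<^bsub>R\<^esub> A $$ ij))\<rparr>"

definition quotient_module ::
  "('r, 'a, 'b) module_scheme \<Rightarrow> 'a set \<Rightarrow> ('r, 'a set) module" where
  "quotient_module M N =
     \<lparr>carrier = a_rcosets\<^bsub>M\<^esub> N, mult = undefined, one = undefined,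
      zero = N, add = set_add M,
      smult = (\<lambda>a X. \<Union>x \<in> X. N +>\<^bsub>M\<^esub> (a \<odot>\<^bsub>M\<^esub> x))\<rparr>"

definition module_isomorphic ::
  "('r, 'p) ring_scheme \<Rightarrow> ('r, 'a, 'b) module_scheme \<Rightarrow> ('r, 'c, 'd) module_scheme \<Rightarrow> bool" where
  "module_isomorphic R M N \<longleftrightarrow>
     (\<exists>f. bij_betw f (carrier M) (carrier N) \<and>
        (\<forall>x \<in> carrier M. \<forall>y \<in> carrier M. f (x \<oplus>\<^bsub>M\<^esub> y) = f x \<oplus>\<^bsub>N\<^esub> f y) \<and>
        (\<forall>a \<in> carrier R. \<forall>x \<in> carrier M. f (a \<odot>\<^bsub>M\<^esub> x) = a \<odot>\<^bsub>N\<^esub> f x))"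

text \<open>
  The structures that the definition of isomorphism is applied to are modules in the sense of
  the library, and scalars act on cosets by \<open>a (N + x) = N + a x\<close>.
\<close>

lemma matsD: "A \<in> mats R m n \<Longrightarrow> i < m \<Longrightarrow> j < n \<Longrightarrow> A $$ (i,j) \<in> carrier R"
  unfolding mats_def elements_mat_def by fastforce

lemma mats_dim: "A \<in> mats R m n \<Longrightarrow> dim_row A = m \<and> dim_col A = n"
  unfolding mats_def by auto

lemma mats_mat: "mat m n f \<in> mats R m n \<longleftrightarrow> (\<forall>i<m. \<forall>j<n. f (i,j) \<in> carrier R)"
proof
  assume "mat m n f \<in> mats R m n"
  then show "\<forall>i<m. \<forall>j<n. f (i,j) \<in> carrier R" using matsD[of "mat m n f" R m n] by auto
qed (auto simp: mats_def dest!: elements_matD)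

lemma (in cring) mat_module_module: "module R (mat_module R m n)"
proof (rule moduleI)
  show "abelian_group (mat_module R m n)"
  proof (rule abelian_groupI)
    fix x assume x: "x \<in> carrier (mat_module R m n)"
    show "\<exists>y\<in>carrier (mat_module R m n). y \<oplus>\<^bsub>mat_module R m n\<^esub> x = \<zero>\<^bsub>mat_module R m n\<^esub>"
      apply (rule bexI[of _ "mat m n (\<lambda>ij. \<ominus> x $$ ij)"])
      using x by (auto simp: mat_module_def mat_zero_def mats_mat matsD mats_dim l_neg intro!: eq_matI)
  qed (auto simp: mat_module_def mat_zero_def mats_mat matsD mats_dim a_ac intro!: eq_matI)
qed (use is_cring in \<open>auto simp: mat_module_def mat_zero_def mats_mat matsD mats_dim m_ac l_distr r_distr intro!: eq_matI\<close>)

lemma quotient_module_smult: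
  assumes "module R M" "submodule N R M" "a \<in> carrier R" "x \<in> carrier M"
  shows "a \<odot>\<^bsub>quotient_module M N\<^esub> (N +>\<^bsub>M\<^esub> x) = N +>\<^bsub>M\<^esub> (a \<odot>\<^bsub>M\<^esub> x)"
proof -
  interpret module R M by fact
  interpret S: submodule N R M by fact
  have N: "abelian_subgroup N M"
    by (intro abelian_subgroupI3 additive_subgroup.intro S.subgroup_axioms abelian_group_axioms)
  interpret N: abelian_subgroup N M by fact
  have *: "N +>\<^bsub>M\<^esub> (a \<odot>\<^bsub>M\<^esub> y) = N +>\<^bsub>M\<^esub> (a \<odot>\<^bsub>M\<^esub> x)" if "y \<in> N +>\<^bsub>M\<^esub> x" for y
  proof -
    from that obtain k where k: "k \<in> N" "y = k \<oplus>\<^bsub>M\<^esub> x" by (auto simp: a_r_coset_def' )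
    have "a \<odot>\<^bsub>M\<^esub> y = a \<odot>\<^bsub>M\<^esub> k \<oplus>\<^bsub>M\<^esub> a \<odot>\<^bsub>M\<^esub> x" using k assms N.a_subset by (auto simp: smult_r_distr)
    then have "a \<odot>\<^bsub>M\<^esub> y \<in> N +>\<^bsub>M\<^esub> (a \<odot>\<^bsub>M\<^esub> x)" using k assms S.smult_closed by (auto simp: a_r_coset_def')
    then show ?thesis using N.a_repr_independence'[of "a \<odot>\<^bsub>M\<^esub> y" "a \<odot>\<^bsub>M\<^esub> x"] assms by simp
  qed
  have "x \<in> N +>\<^bsub>M\<^esub> x" using assms N.a_rcos_self by auto
  then have "(\<Union>y \<in> N +>\<^bsub>M\<^esub> x. N +>\<^bsub>M\<^esub> (a \<odot>\<^bsub>M\<^esub> y)) = N +>\<^bsub>M\<^esub> (a \<odot>\<^bsub>M\<^esub> x)"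
    using * by blast
  then show ?thesis by (simp add: quotient_module_def)
qed

lemma quotient_module_module:
  assumes "module R M" "submodule N R M"
  shows "module R (quotient_module M N)"
proof -
  interpret module R M by fact
  interpret S: submodule N R M by fact
  interpret N: abelian_subgroup N M
    by (intro abelian_subgroupI3 additive_subgroup.intro S.subgroup_axioms abelian_group_axioms)
  have car: "X \<in> carrier (quotient_module M N) \<longleftrightarrow> (\<exists>x\<in>carrier M. X = N +>\<^bsub>M\<^esub> x)" for X
    by (auto simp: quotient_module_def A_RCOSETS_def')
  have add: "(N +>\<^bsub>M\<^esub> x) \<oplus>\<^bsub>quotient_module M N\<^esub> (N +>\<^bsub>M\<^esub> y) = N +>\<^bsub>M\<^esub> (x \<oplus>\<^bsub>M\<^esub> y)"
    if "x \<in> carrier M" "y \<in> carrier M" for x y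
    using that N.a_rcos_sum by (simp add: quotient_module_def)
  have z: "\<zero>\<^bsub>quotient_module M N\<^esub> = N +>\<^bsub>M\<^esub> \<zero>\<^bsub>M\<^esub>"
    using N.a_subset by (simp add: quotient_module_def a_coset_add_zero)
  note sm = quotient_module_smult[OF assms]
  show ?thesis
  proof (rule moduleI)
    show "abelian_group (quotient_module M N)"
    proof (rule abelian_groupI)
      fix X assume "X \<in> carrier (quotient_module M N)"
      then obtain x where x: "x \<in> carrier M" "X = N +>\<^bsub>M\<^esub> x" by (auto simp: car)
      show "\<exists>Y\<in>carrier (quotient_module M N). Y \<oplus>\<^bsub>quotient_module M N\<^esub> X = \<zero>\<^bsub>quotient_module M N\<^esub>"
        by (rule bexI[of _ "N +>\<^bsub>M\<^esub> (\<ominus>\<^bsub>M\<^esub> x)"]) (use x in \<open>auto simp: car add z M.l_neg\<close>)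
    qed (auto simp: car add z M.a_ac)
  qed (use R.is_cring in \<open>auto simp: car add sm smult_l_distr smult_r_distr smult_assoc1\<close>)
qed

lemma (in cring) Row_submodule:
  assumes A: "A \<in> mats R m n"
  shows "submodule (Row R A) R (mat_module R 1 n)"
proof -
  interpret M: Module.module R "mat_module R 1 n" by (rule mat_module_module)
  interpret U: Module.module R "mat_module R 1 m" by (rule mat_module_module)
  have d: "dim_row A = m" "dim_col A = n" using A by (auto simp: mats_dim)
  have cl: "mat_mult R u A \<in> carrier (mat_module R 1 n)" if "u \<in> carrier (mat_module R 1 m)" for u
  proof -
    have "(\<Oplus>k\<in>{..<m}. u $$ (i,k) \<otimes> A $$ (k,j)) \<in> carrier R" if "i < 1" "j < n" for i j
      using that \<open>u \<in> _\<close> A by (intro finsum_closed) (simp add: mat_module_def matsD Pi_def)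
    then show ?thesis using that by (simp add: mat_module_def mat_mult_def mats_dim d mats_mat)
  qed
  have add: "mat_mult R (u \<oplus>\<^bsub>mat_module R 1 m\<^esub> u') A = mat_mult R u A \<oplus>\<^bsub>mat_module R 1 n\<^esub> mat_mult R u' A"
    if "u \<in> carrier (mat_module R 1 m)" "u' \<in> carrier (mat_module R 1 m)" for u u'
  proof (rule eq_matI)
    fix i j assume "i < dim_row (mat_mult R u A \<oplus>\<^bsub>mat_module R 1 n\<^esub> mat_mult R u' A)"
      "j < dim_col (mat_mult R u A \<oplus>\<^bsub>mat_module R 1 n\<^esub> mat_mult R u' A)"
    then have j: "i = 0" "j < n" by (simp_all add: mat_module_def)
    have c: "u $$ (0,k) \<in> carrier R" "u' $$ (0,k) \<in> carrier R" "A $$ (k,j) \<in> carrier R" if "k < m" for k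
      using j that \<open>u \<in> _\<close> \<open>u' \<in> _\<close> A by (auto simp: mat_module_def matsD)
    have "(\<Oplus>k\<in>{..<m}. mat 1 m (\<lambda>ij. u $$ ij \<oplus> u' $$ ij) $$ (0,k) \<otimes> A $$ (k,j))
      = (\<Oplus>k\<in>{..<m}. u $$ (0,k) \<otimes> A $$ (k,j) \<oplus> u' $$ (0,k) \<otimes> A $$ (k,j))"
      using c by (intro add.finprod_cong') (simp_all add: l_distr Pi_def)
    also have "\<dots> = (\<Oplus>k\<in>{..<m}. u $$ (0,k) \<otimes> A $$ (k,j)) \<oplus> (\<Oplus>k\<in>{..<m}. u' $$ (0,k) \<otimes> A $$ (k,j))"
      using c by (intro finsum_addf) (simp_all add: Pi_def)
    finally show "mat_mult R (u \<oplus>\<^bsub>mat_module R 1 m\<^esub> u') A $$ (i,j)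
      = (mat_mult R u A \<oplus>\<^bsub>mat_module R 1 n\<^esub> mat_mult R u' A) $$ (i,j)"
      using that j by (simp add: mat_module_def mat_mult_def mats_dim d)
  qed (use that in \<open>simp_all add: mat_module_def mat_mult_def mats_dim d\<close>)
  have sm: "mat_mult R (a \<odot>\<^bsub>mat_module R 1 m\<^esub> u) A = a \<odot>\<^bsub>mat_module R 1 n\<^esub> mat_mult R u A"
    if "u \<in> carrier (mat_module R 1 m)" "a \<in> carrier R" for u a
  proof (rule eq_matI)
    fix i j assume "i < dim_row (a \<odot>\<^bsub>mat_module R 1 n\<^esub> mat_mult R u A)"
      "j < dim_col (a \<odot>\<^bsub>mat_module R 1 n\<^esub> mat_mult R u A)"
    then have j: "i = 0" "j < n" by (simp_all add: mat_module_def)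
    have c: "u $$ (0,k) \<in> carrier R" "A $$ (k,j) \<in> carrier R" if "k < m" for k
      using j that \<open>u \<in> _\<close> A by (auto simp: mat_module_def matsD)
    have "(\<Oplus>k\<in>{..<m}. mat 1 m (\<lambda>ij. a \<otimes> u $$ ij) $$ (0,k) \<otimes> A $$ (k,j))
      = (\<Oplus>k\<in>{..<m}. a \<otimes> (u $$ (0,k) \<otimes> A $$ (k,j)))"
      using c \<open>a \<in> _\<close> by (intro add.finprod_cong') (simp_all add: m_assoc Pi_def)
    also have "\<dots> = a \<otimes> (\<Oplus>k\<in>{..<m}. u $$ (0,k) \<otimes> A $$ (k,j))"
      using c \<open>a \<in> _\<close> by (intro finsum_rdistr[symmetric]) (simp_all add: Pi_def)
    finally show "mat_mult R (a \<odot>\<^bsub>mat_module R 1 m\<^esub> u) A $$ (i,j)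
      = (a \<odot>\<^bsub>mat_module R 1 n\<^esub> mat_mult R u A) $$ (i,j)"
      using that j by (simp add: mat_module_def mat_mult_def mats_dim d)
  qed (use that in \<open>simp_all add: mat_module_def mat_mult_def mats_dim d\<close>)
  have Row: "x \<in> Row R A \<longleftrightarrow> (\<exists>u \<in> carrier (mat_module R 1 m). x = mat_mult R u A)" for x
    by (auto simp: Row_def d mat_module_def)
  have smR: "a \<odot>\<^bsub>mat_module R 1 n\<^esub> x \<in> Row R A" if "a \<in> carrier R" "x \<in> Row R A" for a x
  proof -
    from that obtain u where u: "u \<in> carrier (mat_module R 1 m)" "x = mat_mult R u A" unfolding Row by blast
    show ?thesis unfolding Row u(2) sm[OF u(1) that(1), symmetric]
      by (rule bexI[OF _ U.smult_closed[OF that(1) u(1)]]) (rule refl)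
  qed
  have addR: "x \<oplus>\<^bsub>mat_module R 1 n\<^esub> y \<in> Row R A" if "x \<in> Row R A" "y \<in> Row R A" for x y
  proof -
    from that obtain u u' where u: "u \<in> carrier (mat_module R 1 m)" "x = mat_mult R u A"
      "u' \<in> carrier (mat_module R 1 m)" "y = mat_mult R u' A" unfolding Row by blast
    show ?thesis unfolding Row u(2,4) add[OF u(1,3), symmetric]
      by (rule bexI[OF _ U.M.a_closed[OF u(1,3)]]) (rule refl)
  qed
  have sub: "Row R A \<subseteq> carrier (mat_module R 1 n)"
  proof
    fix x assume "x \<in> Row R A"
    then obtain u where u: "u \<in> carrier (mat_module R 1 m)" "x = mat_mult R u A" unfolding Row by blast
    show "x \<in> carrier (mat_module R 1 n)" unfolding u(2) by (rule cl[OF u(1)])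
  qed
  have "mat_zero R 1 m \<in> carrier (mat_module R 1 m)"
    by (simp add: mat_module_def mat_zero_def mats_mat)
  then have x: "mat_mult R (mat_zero R 1 m) A \<in> Row R A"
    unfolding Row by (rule bexI[rotated]) (rule refl)
  show ?thesis
  proof (rule M.submoduleI)
    show "\<zero>\<^bsub>mat_module R 1 n\<^esub> \<in> Row R A"
      using smR[OF zero_closed x] M.smult_l_null[OF subsetD[OF sub x]] by argo
    show "\<ominus>\<^bsub>mat_module R 1 n\<^esub> x \<in> Row R A" if "x \<in> Row R A" for x
      using smR[OF a_inv_closed[OF one_closed] that] M.smult_one[OF subsetD[OF sub that]]
        M.smult_l_minus[OF one_closed subsetD[OF sub that]] by argo
  qed (fact sub addR smR)+
qed

lemma (in cring) orth_compl_submodule: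
  assumes X: "X \<subseteq> mats R 1 n"
  shows "submodule (orth_compl R n X) R (mat_module R n 1)"
proof -
  interpret M: Module.module R "mat_module R n 1" by (rule mat_module_module)
  have XD: "dim_row x = 1" "dim_col x = n" "\<And>j. j < n \<Longrightarrow> x $$ (0,j) \<in> carrier R" if "x \<in> X" for x
    using X that by (auto simp: mats_dim dest!: subsetD intro!: matsD)
  have O: "v \<in> orth_compl R n X \<longleftrightarrow> v \<in> mats R n 1 \<and>
     (\<forall>x\<in>X. (\<Oplus>k\<in>{..<n}. x $$ (0,k) \<otimes> v $$ (k,0)) = \<zero>)" for v
  proof -
    have "mat_mult R x v = mat_zero R 1 1 \<longleftrightarrow> (\<Oplus>k\<in>{..<n}. x $$ (0,k) \<otimes> v $$ (k,0)) = \<zero>"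
      if "v \<in> mats R n 1" "x \<in> X" for x
      using XD[OF that(2)] that(1) by (auto simp: mat_mult_def mat_zero_def mats_dim mat_eq_iff)
    then show ?thesis by (auto simp: orth_compl_def)
  qed
  have OI: "mat n 1 f \<in> orth_compl R n X"
    if "\<And>k. k < n \<Longrightarrow> f (k, 0) \<in> carrier R" "\<And>x. x \<in> X \<Longrightarrow> (\<Oplus>k\<in>{..<n}. x $$ (0,k) \<otimes> f (k,0)) = \<zero>" for f
  proof -
    have "(\<Oplus>k\<in>{..<n}. x $$ (0,k) \<otimes> mat n 1 f $$ (k,0)) = (\<Oplus>k\<in>{..<n}. x $$ (0,k) \<otimes> f (k,0))" if "x \<in> X" for x
      using XD[OF that] \<open>\<And>k. k < n \<Longrightarrow> f (k, 0) \<in> carrier R\<close> by (intro add.finprod_cong') auto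
    then show ?thesis using that by (auto simp: O mats_mat)
  qed
  have sub: "orth_compl R n X \<subseteq> carrier (mat_module R n 1)"
    by (auto simp: orth_compl_def mat_module_def)
  have smR: "a \<odot>\<^bsub>mat_module R n 1\<^esub> v \<in> orth_compl R n X"
    if a: "a \<in> carrier R" and v: "v \<in> orth_compl R n X" for a v
  proof -
    have vc: "\<And>k. k < n \<Longrightarrow> v $$ (k,0) \<in> carrier R" using v by (auto simp: O matsD)
    have "(\<Oplus>k\<in>{..<n}. x $$ (0,k) \<otimes> (a \<otimes> v $$ (k,0))) = a \<otimes> (\<Oplus>k\<in>{..<n}. x $$ (0,k) \<otimes> v $$ (k,0))" if "x \<in> X" for x
      using XD[OF that] vc a by (subst finsum_rdistr) (auto simp: m_lcomm intro!: add.finprod_cong')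
    then show ?thesis using a v vc by (auto simp: O mat_module_def intro!: OI[simplified])
  qed
  have addR: "v \<oplus>\<^bsub>mat_module R n 1\<^esub> w \<in> orth_compl R n X"
    if v: "v \<in> orth_compl R n X" and w: "w \<in> orth_compl R n X" for v w
  proof -
    have vc: "\<And>k. k < n \<Longrightarrow> v $$ (k,0) \<in> carrier R" "\<And>k. k < n \<Longrightarrow> w $$ (k,0) \<in> carrier R"
      using v w by (auto simp: O matsD)
    have "(\<Oplus>k\<in>{..<n}. x $$ (0,k) \<otimes> (v $$ (k,0) \<oplus> w $$ (k,0)))
      = (\<Oplus>k\<in>{..<n}. x $$ (0,k) \<otimes> v $$ (k,0)) \<oplus> (\<Oplus>k\<in>{..<n}. x $$ (0,k) \<otimes> w $$ (k,0))" if "x \<in> X" for x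
    proof -
      have "(\<Oplus>k\<in>{..<n}. x $$ (0,k) \<otimes> (v $$ (k,0) \<oplus> w $$ (k,0)))
        = (\<Oplus>k\<in>{..<n}. x $$ (0,k) \<otimes> v $$ (k,0) \<oplus> x $$ (0,k) \<otimes> w $$ (k,0))"
        using XD(3)[OF that] vc by (intro add.finprod_cong') (simp_all add: r_distr Pi_def)
      also have "\<dots> = (\<Oplus>k\<in>{..<n}. x $$ (0,k) \<otimes> v $$ (k,0)) \<oplus> (\<Oplus>k\<in>{..<n}. x $$ (0,k) \<otimes> w $$ (k,0))"
        using XD(3)[OF that] vc by (intro finsum_addf) (simp_all add: Pi_def)
      finally show ?thesis .
    qed
    then show ?thesis using v w vc by (auto simp: O mat_module_def intro!: OI[simplified])
  qed
  have z: "\<zero>\<^bsub>mat_module R n 1\<^esub> \<in> orth_compl R n X"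
  proof -
    have "(\<Oplus>k\<in>{..<n}. x $$ (0,k) \<otimes> \<zero>) = \<zero>" if "x \<in> X" for x
      using XD[OF that] by (intro add.finprod_one_eqI) auto
    then show ?thesis by (auto simp: mat_module_def mat_zero_def intro!: OI[simplified])
  qed
  show ?thesis
  proof (rule M.submoduleI)
    show "\<ominus>\<^bsub>mat_module R n 1\<^esub> x \<in> orth_compl R n X" if "x \<in> orth_compl R n X" for x
      using smR[of "\<ominus> \<one>" x] M.smult_l_minus[of \<one> x] M.smult_one[of x] that sub by (metis add.inv_closed one_closed subsetD a_inv_closed)
  qed (use sub smR addR z in auto)
qed

end

theory Submission
  imports Defs
begin

text \<open>
  Call an \<open>R\<close>-linear endomorphism \<open>\<sigma>\<close> of \<open>R\<^sup>n\<close> a duality map for a submodule \<open>N\<close> if \<open>\<sigma>\<close> is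
  symmetric for the standard bilinear form, has kernel \<open>N\<close>, and has image \<open>N\<^sup>\<bottom>\<close>.  Once
  \<open>N = Row(A)\<close> (up to transposition) has a duality map, both claims follow.  The first
  isomorphism theorem gives \<open>N\<^sup>\<bottom> \<cong> R\<^sup>n / N\<close>.  If \<open>x \<notin> N\<close>, then some coordinate of \<open>\<sigma> x\<close> is
  nonzero, i.e. \<open>(\<sigma> x) \<cdot> e\<^sub>i \<noteq> 0\<close>; by symmetry \<open>x \<cdot> \<sigma> e\<^sub>i \<noteq> 0\<close>, while \<open>\<sigma> e\<^sub>i \<in> N\<^sup>\<bottom>\<close> is
  annihilated by \<open>A\<close>.  This is the row condition of exactness; the column condition is
  the row condition for the transposed matrix.

  Three properties of \<open>R = P/rP\<close> are used to construct duality maps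
  (\<open>quotient_self_dual_pir\<close>): every ideal is principal; any \<open>a\<close>, \<open>b\<close> are of the form \<open>g a'\<close>, \<open>g b'\<close>
  with \<open>a'\<close>, \<open>b'\<close> generating the unit ideal; and for every \<open>d\<close> there is an \<open>e\<close> with
  \<open>Ann(e) = dR\<close> and \<open>Ann(d) = eR\<close>.  For the last one, lift \<open>d\<close> to \<open>P\<close>, let \<open>g\<close> be a greatest
  common divisor of \<open>d\<close> and \<open>r\<close>, and take \<open>e = r/g\<close>; this needs \<open>r \<noteq> 0\<close>.

  A duality map for \<open>N\<close> is built by induction on \<open>n\<close> (\<open>duality_map_exists\<close>), which amounts to a
  diagonalisation using coordinate changes of \<open>R\<^sup>n\<close> only.  The last coordinates of the elements
  of \<open>N\<close> form an ideal \<open>dR\<close>; let \<open>z \<in> N\<close> have last coordinate \<open>d\<close>.  If another coordinate of \<open>z\<close>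
  is not a multiple of \<open>d\<close>, a coordinate change of determinant 1 turns the last coordinate of
  \<open>z\<close> into the greatest common divisor of the two and so enlarges the ideal, which can happen only
  finitely often.  If it is a nonzero multiple of \<open>d\<close>, a shear clears it.  In the end
  \<open>z = d e\<^sub>n\<close>, so \<open>N\<close> is the direct sum of \<open>R z\<close> and a submodule of the space of the other
  coordinates.  A duality map for the latter is extended by multiplication with \<open>e\<close> on the last
  coordinate (\<open>duality_map_snoc\<close>).  Duality maps are transported back along a coordinate change and its
  adjoint (\<open>duality_map_pullback\<close>).
\<close>

section \<open>Linear maps between modules\<close>

text \<open>
  Homomorphisms of \<open>R\<close>-modules.  Values outside the carrier are unconstrained.
\<close>

definition linear_on ::
  "('r, 'p) ring_scheme \<Rightarrow> ('r, 'a, 'b) module_scheme \<Rightarrow> ('r, 'c, 'd) module_scheme \<Rightarrow> ('a \<Rightarrow> 'c) \<Rightarrow> bool" where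
  "linear_on R M N f \<longleftrightarrow> f \<in> carrier M \<rightarrow> carrier N \<and>
     (\<forall>x \<in> carrier M. \<forall>y \<in> carrier M. f (x \<oplus>\<^bsub>M\<^esub> y) = f x \<oplus>\<^bsub>N\<^esub> f y) \<and>
     (\<forall>a \<in> carrier R. \<forall>x \<in> carrier M. f (a \<odot>\<^bsub>M\<^esub> x) = a \<odot>\<^bsub>N\<^esub> f x)"

lemma linear_onD:
  assumes "linear_on R M N f"
  shows "x \<in> carrier M \<Longrightarrow> f x \<in> carrier N"
    and "x \<in> carrier M \<Longrightarrow> y \<in> carrier M \<Longrightarrow> f (x \<oplus>\<^bsub>M\<^esub> y) = f x \<oplus>\<^bsub>N\<^esub> f y"
    and "a \<in> carrier R \<Longrightarrow> x \<in> carrier M \<Longrightarrow> f (a \<odot>\<^bsub>M\<^esub> x) = a \<odot>\<^bsub>N\<^esub> f x"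
  using assms by (auto simp: linear_on_def)

lemma linear_on_comp:
  assumes "linear_on R M N f" "linear_on R N K g"
  shows "linear_on R M K (\<lambda>x. g (f x))"
  using assms by (auto simp: linear_on_def Pi_iff)

lemma (in module) submoduleI_add_smult:
  assumes "H \<subseteq> carrier M" "\<zero>\<^bsub>M\<^esub> \<in> H"
    and "\<And>x y. x \<in> H \<Longrightarrow> y \<in> H \<Longrightarrow> x \<oplus>\<^bsub>M\<^esub> y \<in> H"
    and sm: "\<And>a x. a \<in> carrier R \<Longrightarrow> x \<in> H \<Longrightarrow> a \<odot>\<^bsub>M\<^esub> x \<in> H"
  shows "submodule H R M"
proof (rule submoduleI)
  fix x assume "x \<in> H"
  then show "\<ominus>\<^bsub>M\<^esub> x \<in> H"
    using sm[of "\<ominus> \<one>" x] smult_l_minus[of \<one> x] assms(1) by auto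
qed (use assms in auto)

lemma submodule_zero_closed: "submodule H R M \<Longrightarrow> \<zero>\<^bsub>M\<^esub> \<in> H"
  using subgroup.one_closed[of H "add_monoid M"] by (simp add: submodule_def)

lemma linear_on_zero:
  assumes "module R M" "module R N" "linear_on R M N f"
  shows "f \<zero>\<^bsub>M\<^esub> = \<zero>\<^bsub>N\<^esub>"
proof -
  interpret M: module R M by fact
  interpret N: module R N by fact
  show ?thesis
    using linear_onD(3)[OF assms(3) M.R.zero_closed M.M.zero_closed]
      linear_onD(1)[OF assms(3) M.M.zero_closed] by simp
qed

lemma linear_on_image_submodule:
  assumes "module R M" "module R N" and f: "linear_on R M N f" and H: "submodule H R M"
  shows "submodule (f ` H) R N"
proof -
  interpret M: module R M by fact
  interpret N: module R N by fact
  note HD = M.submoduleE[OF H]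
  show ?thesis
  proof (rule N.submoduleI_add_smult)
    show "f ` H \<subseteq> carrier N" using HD(1) linear_onD(1)[OF f] by auto
    show "\<zero>\<^bsub>N\<^esub> \<in> f ` H"
      using linear_on_zero[OF assms(1-3)] submodule_zero_closed[OF H] by force
    show "x \<oplus>\<^bsub>N\<^esub> y \<in> f ` H" if xy: "x \<in> f ` H" "y \<in> f ` H" for x y
    proof -
      from xy obtain u v where u: "u \<in> H" "v \<in> H" "x = f u" "y = f v" by blast
      then have "u \<in> carrier M" "v \<in> carrier M" using HD(1) by blast+
      then have "x \<oplus>\<^bsub>N\<^esub> y = f (u \<oplus>\<^bsub>M\<^esub> v)" using linear_onD(2)[OF f, of u v] u by simp
      then show ?thesis using HD(5) u by blast
    qed
    show "a \<odot>\<^bsub>N\<^esub> x \<in> f ` H" if ax: "a \<in> carrier R" "x \<in> f ` H" for a x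
    proof -
      from ax obtain u where u: "u \<in> H" "x = f u" by blast
      then have "u \<in> carrier M" using HD(1) by blast
      then have "a \<odot>\<^bsub>N\<^esub> x = f (a \<odot>\<^bsub>M\<^esub> u)" using ax u linear_onD(3)[OF f, of a u] by simp
      then show ?thesis using HD(4) u ax by blast
    qed
  qed
qed

text \<open>
  The first isomorphism theorem.  The isomorphism maps a vector of the image to its fibre, which
  is a coset of the kernel.
\<close>

lemma image_isomorphic_quotient:
  assumes "module R M" "module R N" and f: "linear_on R M N f" and H: "submodule H R M"
    and ker: "\<And>x. x \<in> carrier M \<Longrightarrow> f x = \<zero>\<^bsub>N\<^esub> \<longleftrightarrow> x \<in> H"
    and K: "K = f ` carrier M"
  shows "module_isomorphic R (N\<lparr>carrier := K\<rparr>) (quotient_module M H)"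
proof -
  interpret M: module R M by fact
  interpret N: module R N by fact
  interpret S: submodule H R M by fact
  interpret H: abelian_subgroup H M
    by (intro abelian_subgroupI3 additive_subgroup.intro S.subgroup_axioms M.abelian_group_axioms)
  define g where "g v = {x \<in> carrier M. f x = v}" for v
  have eq: "f x = f y \<longleftrightarrow> y \<oplus>\<^bsub>M\<^esub> \<ominus>\<^bsub>M\<^esub> x \<in> H" if xy: "x \<in> carrier M" "y \<in> carrier M" for x y
  proof -
    have "f (\<ominus>\<^bsub>M\<^esub> x) = \<ominus>\<^bsub>N\<^esub> f x"
      using linear_onD(3)[OF f, of "\<ominus>\<^bsub>R\<^esub> \<one>\<^bsub>R\<^esub>" x] M.smult_l_minus[of "\<one>\<^bsub>R\<^esub>" x]
        N.smult_l_minus[of "\<one>\<^bsub>R\<^esub>" "f x"] linear_onD(1)[OF f] xy by auto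
    then have "f (y \<oplus>\<^bsub>M\<^esub> \<ominus>\<^bsub>M\<^esub> x) = f y \<oplus>\<^bsub>N\<^esub> \<ominus>\<^bsub>N\<^esub> f x"
      using linear_onD(2)[OF f] xy by auto
    moreover have "f y \<oplus>\<^bsub>N\<^esub> \<ominus>\<^bsub>N\<^esub> f x = \<zero>\<^bsub>N\<^esub> \<longleftrightarrow> f x = f y"
      using xy linear_onD(1)[OF f] N.M.minus_equality[of "f y" "\<ominus>\<^bsub>N\<^esub> f x"] N.M.r_neg by force
    ultimately show ?thesis using ker[of "y \<oplus>\<^bsub>M\<^esub> \<ominus>\<^bsub>M\<^esub> x"] xy by auto
  qed
  have g: "g (f x) = H +>\<^bsub>M\<^esub> x" if "x \<in> carrier M" for x
  proof -
    have "y \<in> g (f x) \<longleftrightarrow> y \<in> H +>\<^bsub>M\<^esub> x" for y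
    proof (cases "y \<in> carrier M")
      case True
      then show ?thesis
        using that eq[of x y] H.a_rcos_module[of x y] by (auto simp: g_def)
    next
      case False
      then show ?thesis
        using H.a_rcosets_carrier[OF M.a_rcosetsI[OF H.a_subset that]] by (auto simp: g_def)
    qed
    then show ?thesis by blast
  qed
  have "bij_betw g K (a_rcosets\<^bsub>M\<^esub> H)"
    unfolding bij_betw_def
  proof
    show "inj_on g K" by (rule inj_onI) (force simp: K g_def)
    show "g ` K = a_rcosets\<^bsub>M\<^esub> H"
      unfolding K image_image A_RCOSETS_def' using g by auto
  qed
  moreover have "g (v \<oplus>\<^bsub>N\<^esub> w) = g v <+>\<^bsub>M\<^esub> g w" if "v \<in> K" "w \<in> K" for v w
  proof -
    from that obtain x y where "x \<in> carrier M" "v = f x" "y \<in> carrier M" "w = f y"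
      by (auto simp: K)
    then show ?thesis using linear_onD(2)[OF f, of x y, symmetric] by (simp add: g H.a_rcos_sum)
  qed
  moreover have "g (a \<odot>\<^bsub>N\<^esub> v) = a \<odot>\<^bsub>quotient_module M H\<^esub> g v"
    if "a \<in> carrier R" "v \<in> K" for a v
  proof -
    from that obtain x where "x \<in> carrier M" "v = f x" by (auto simp: K)
    then have "g (a \<odot>\<^bsub>N\<^esub> v) = H +>\<^bsub>M\<^esub> (a \<odot>\<^bsub>M\<^esub> x)" "g v = H +>\<^bsub>M\<^esub> x"
      using that g linear_onD(3)[OF f, of a x] by (metis M.smult_closed)+
    then show ?thesis
      using quotient_module_smult[OF assms(1) H] that \<open>x \<in> carrier M\<close> by simp
  qed
  ultimately show ?thesis
    unfolding module_isomorphic_def by (intro exI[of _ g]) (simp add: quotient_module_def)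
qed

section \<open>Principal ideal rings in which annihilators are dual\<close>

text \<open>
  The cofactors of the greatest common divisor \<open>g\<close> are made explicit, so that the statement
  also covers \<open>a = b = 0\<close> and passes to quotient rings.
\<close>

lemma (in principal_domain) bezout_cofactors:
  assumes a: "a \<in> carrier R" and b: "b \<in> carrier R"
  shows "\<exists>g \<in> carrier R. \<exists>s \<in> carrier R. \<exists>t \<in> carrier R. \<exists>a' \<in> carrier R. \<exists>b' \<in> carrier R.
    a = g \<otimes> a' \<and> b = g \<otimes> b' \<and> s \<otimes> a' \<oplus> t \<otimes> b' = \<one>"
proof (cases "a = \<zero> \<and> b = \<zero>")
  case True
  then show ?thesis
    by (intro bexI[of _ \<zero>] bexI[of _ \<one>] conjI) auto
next
  case False
  have "ideal (PIdl a <+> PIdl b) R"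
    using a b by (intro add_ideals cgenideal_ideal)
  then obtain g where g: "g \<in> carrier R" "PIdl a <+> PIdl b = PIdl g"
    using exists_gen by blast
  have mem: "x \<in> PIdl a <+> PIdl b \<longleftrightarrow> (\<exists>s\<in>carrier R. \<exists>t\<in>carrier R. x = s \<otimes> a \<oplus> t \<otimes> b)" for x
    by (auto simp: set_add_def' cgenideal_def)
  have "a \<in> PIdl g" "b \<in> PIdl g"
    unfolding g(2)[symmetric] mem using a b
    by (rule_tac bexI[of _ \<one>], rule_tac bexI[of _ \<zero>], auto)
      (rule_tac bexI[of _ \<zero>], rule_tac bexI[of _ \<one>], auto)
  then obtain a' b' where ab: "a' \<in> carrier R" "a = g \<otimes> a'" "b' \<in> carrier R" "b = g \<otimes> b'"
    using g by (auto simp: cgenideal_def m_comm)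
  have "g \<in> PIdl a <+> PIdl b" unfolding g(2) using g(1) by (rule cgenideal_self)
  then obtain s t where st: "s \<in> carrier R" "t \<in> carrier R" "g = s \<otimes> a \<oplus> t \<otimes> b"
    unfolding mem by blast
  have "g \<noteq> \<zero>" using False ab by auto
  moreover have "g \<otimes> (s \<otimes> a' \<oplus> t \<otimes> b') = g \<otimes> \<one>"
  proof -
    have "g \<otimes> (s \<otimes> a' \<oplus> t \<otimes> b') = s \<otimes> (g \<otimes> a') \<oplus> t \<otimes> (g \<otimes> b')"
      using g ab(1,3) st(1,2) by algebra
    then show ?thesis
      unfolding ab(2,4)[symmetric] st(3)[symmetric] r_one[OF g(1)] .
  qed
  ultimately have "s \<otimes> a' \<oplus> t \<otimes> b' = \<one>"
    using g(1) ab(1,3) st(1,2) m_lcancel[of g "s \<otimes> a' \<oplus> t \<otimes> b'" \<one>] by blast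
  then show ?thesis using g(1) ab st(1,2) by (intro bexI conjI)
qed

text \<open>
  Commutative rings, possibly with zero divisors, over which the arguments below work: every ideal
  is principal, pairs of elements have a greatest common divisor with comaximal cofactors, and
  every principal ideal \<open>dR\<close> is the annihilator of an element \<open>e\<close> with \<open>Ann(d) = eR\<close>.
\<close>

locale self_dual_pir = cring +
  assumes ideal_principal: "ideal I R \<Longrightarrow> \<exists>d \<in> carrier R. I = PIdl d"
    and cofactors: "\<lbrakk>a \<in> carrier R; b \<in> carrier R\<rbrakk> \<Longrightarrow>
      \<exists>g \<in> carrier R. \<exists>s \<in> carrier R. \<exists>t \<in> carrier R. \<exists>a' \<in> carrier R. \<exists>b' \<in> carrier R.
        a = g \<otimes> a' \<and> b = g \<otimes> b' \<and> s \<otimes> a' \<oplus> t \<otimes> b' = \<one>"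
    and dual_annihilator: "d \<in> carrier R \<Longrightarrow> \<exists>e \<in> carrier R. \<forall>x \<in> carrier R.
        (x \<otimes> e = \<zero> \<longleftrightarrow> x \<in> PIdl d) \<and> (x \<otimes> d = \<zero> \<longleftrightarrow> x \<in> PIdl e)"

text \<open>
  The dual annihilators come from \<open>r \<noteq> 0\<close>: writing \<open>d = g d'\<close> and \<open>r = g e\<close> with \<open>d'\<close> and \<open>e\<close>
  comaximal, both \<open>g\<close> and \<open>e\<close> are nonzero and can be cancelled in \<open>P\<close>, so that
  \<open>x e \<in> r P\<close> iff \<open>x \<in> g P = d P + r P\<close>, and \<open>x d \<in> r P\<close> iff \<open>x \<in> e P\<close>.  The ring \<open>P\<close> is
  called \<open>R\<close> here, and its quotient \<open>Q\<close>.
\<close>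

lemma (in principal_domain) quotient_self_dual_pir:
  assumes r: "r \<in> carrier R" "r \<noteq> \<zero>"
  shows "self_dual_pir (R Quot (PIdl r))"
proof -
  define I where "I = PIdl r"
  define Q where "Q = R Quot I"
  interpret I: ideal I R unfolding I_def using r(1) by (rule cgenideal_ideal)
  interpret Q: cring Q unfolding Q_def by (rule I.quotient_is_cring) (rule is_cring)
  interpret h: ring_hom_cring R Q "(+>) I"
    unfolding Q_def by (rule I.rcos_ring_hom_cring) (rule is_cring)
  have hr: "ring_hom_ring R Q ((+>) I)"
    unfolding Q_def by (rule I.rcos_ring_hom_ring)
  have carQ: "X \<in> carrier Q \<longleftrightarrow> (\<exists>x \<in> carrier R. X = I +> x)" for X
    unfolding Q_def FactRing_def A_RCOSETS_def' by auto
  have zero: "I +> x = \<zero>\<^bsub>Q\<^esub> \<longleftrightarrow> (\<exists>c \<in> carrier R. x = c \<otimes> r)" if "x \<in> carrier R" for x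
  proof -
    have "I +> x = \<zero>\<^bsub>Q\<^esub> \<longleftrightarrow> x \<in> I"
      unfolding Q_def FactRing_def
      using that I.a_rcos_const[of x] I.rcos_const_imp_mem[of x] by (simp, blast)
    then show ?thesis unfolding I_def cgenideal_def by blast
  qed
  have "self_dual_pir Q"
  proof
    fix J assume J: "ideal J Q"
    then interpret J: ideal J Q .
    have "ideal {x \<in> carrier R. I +> x \<in> J} R"
      using ring_hom_ring.ideal_vimage[OF hr J] .
    then obtain a where a: "a \<in> carrier R" "{x \<in> carrier R. I +> x \<in> J} = PIdl a"
      using exists_gen by blast
    have "J = PIdl\<^bsub>Q\<^esub> (I +> a)"
    proof
      show "J \<subseteq> PIdl\<^bsub>Q\<^esub> (I +> a)"
      proof
        fix X assume X: "X \<in> J"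
        then obtain x where x: "x \<in> carrier R" "X = I +> x" using J.a_subset carQ[of X] by blast
        then have "x \<in> PIdl a" using X a(2) by blast
        then obtain c where "c \<in> carrier R" "x = c \<otimes> a" by (auto simp: cgenideal_def)
        then show "X \<in> PIdl\<^bsub>Q\<^esub> (I +> a)"
          using x(2) a(1) h.hom_closed[of c] by (auto simp: cgenideal_def)
      qed
      have "I +> a \<in> J" using a cgenideal_self by blast
      then show "PIdl\<^bsub>Q\<^esub> (I +> a) \<subseteq> J" by (rule Q.cgenideal_minimal[OF J])
    qed
    then show "\<exists>d\<in>carrier Q. J = PIdl\<^bsub>Q\<^esub> d" using h.hom_closed[OF a(1)] by blast
  next
    fix A B assume "A \<in> carrier Q" "B \<in> carrier Q"
    then obtain a b where ab: "a \<in> carrier R" "A = I +> a" "b \<in> carrier R" "B = I +> b"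
      using carQ[of A] carQ[of B] by blast
    from bezout_cofactors[OF ab(1,3)] obtain g s t a' b' where
      *: "g \<in> carrier R" "s \<in> carrier R" "t \<in> carrier R" "a' \<in> carrier R" "b' \<in> carrier R"
        "a = g \<otimes> a'" "b = g \<otimes> b'" "s \<otimes> a' \<oplus> t \<otimes> b' = \<one>" by blast
    have "I +> (s \<otimes> a' \<oplus> t \<otimes> b') = \<one>\<^bsub>Q\<^esub>" using * h.hom_one by simp
    then have "(I +> s) \<otimes>\<^bsub>Q\<^esub> (I +> a') \<oplus>\<^bsub>Q\<^esub> (I +> t) \<otimes>\<^bsub>Q\<^esub> (I +> b') = \<one>\<^bsub>Q\<^esub>" using *(1-5) by simp
    moreover have "A = (I +> g) \<otimes>\<^bsub>Q\<^esub> (I +> a')" "B = (I +> g) \<otimes>\<^bsub>Q\<^esub> (I +> b')"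
      using ab * by simp_all
    ultimately show "\<exists>g\<in>carrier Q. \<exists>s\<in>carrier Q. \<exists>t\<in>carrier Q. \<exists>a'\<in>carrier Q. \<exists>b'\<in>carrier Q.
        A = g \<otimes>\<^bsub>Q\<^esub> a' \<and> B = g \<otimes>\<^bsub>Q\<^esub> b' \<and> s \<otimes>\<^bsub>Q\<^esub> a' \<oplus>\<^bsub>Q\<^esub> t \<otimes>\<^bsub>Q\<^esub> b' = \<one>\<^bsub>Q\<^esub>"
      using *(1-5)[THEN h.hom_closed] by blast
  next
    fix D assume "D \<in> carrier Q"
    then obtain d where d: "d \<in> carrier R" "D = I +> d" using carQ[of D] by blast
    from bezout_cofactors[OF d(1) r(1)] obtain g s t d' e where
      *: "g \<in> carrier R" "s \<in> carrier R" "t \<in> carrier R" "d' \<in> carrier R" "e \<in> carrier R"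
        "d = g \<otimes> d'" "r = g \<otimes> e" "s \<otimes> d' \<oplus> t \<otimes> e = \<one>" by blast
    have nz: "g \<noteq> \<zero>" "e \<noteq> \<zero>" using r * by auto
    have "I +> (d \<otimes> e) = \<zero>\<^bsub>Q\<^esub>"
    proof -
      have "d \<otimes> e = d' \<otimes> r" using *(1,4,5) unfolding *(6,7) by algebra
      then show ?thesis using zero[of "d \<otimes> e"] d(1) *(4,5) by blast
    qed
    then have DE: "D \<otimes>\<^bsub>Q\<^esub> (I +> e) = \<zero>\<^bsub>Q\<^esub>" using d * by simp
    have "(X \<otimes>\<^bsub>Q\<^esub> (I +> e) = \<zero>\<^bsub>Q\<^esub> \<longleftrightarrow> X \<in> PIdl\<^bsub>Q\<^esub> D) \<and>
          (X \<otimes>\<^bsub>Q\<^esub> D = \<zero>\<^bsub>Q\<^esub> \<longleftrightarrow> X \<in> PIdl\<^bsub>Q\<^esub> (I +> e))" if X: "X \<in> carrier Q" for X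
    proof -
      obtain x where x: "x \<in> carrier R" "X = I +> x" using X carQ[of X] by blast
      have "X \<in> PIdl\<^bsub>Q\<^esub> D" if "X \<otimes>\<^bsub>Q\<^esub> (I +> e) = \<zero>\<^bsub>Q\<^esub>"
      proof -
        have "I +> (x \<otimes> e) = \<zero>\<^bsub>Q\<^esub>" using that x * by simp
        then obtain c where c: "c \<in> carrier R" "x \<otimes> e = c \<otimes> r"
          using zero[of "x \<otimes> e"] x(1) *(5) by blast
        then have "x \<otimes> e = (c \<otimes> g) \<otimes> e" using * by (simp add: m_assoc)
        then have xc: "x = c \<otimes> g" using m_rcancel nz x c * by simp
        have "c \<otimes> g = (c \<otimes> g) \<otimes> (s \<otimes> d' \<oplus> t \<otimes> e)" using c * by simp
        also have "\<dots> = (c \<otimes> s) \<otimes> d \<oplus> (c \<otimes> t) \<otimes> r"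
          unfolding *(6,7) using c(1) *(1-5) by algebra
        finally have "X = I +> ((c \<otimes> s) \<otimes> d \<oplus> (c \<otimes> t) \<otimes> r)" using x xc by simp
        also have "\<dots> = (I +> (c \<otimes> s)) \<otimes>\<^bsub>Q\<^esub> D \<oplus>\<^bsub>Q\<^esub> (I +> ((c \<otimes> t) \<otimes> r))"
          using c(1) *(1-5) d r by simp
        also have "I +> ((c \<otimes> t) \<otimes> r) = \<zero>\<^bsub>Q\<^esub>"
          using zero[of "(c \<otimes> t) \<otimes> r"] c(1) *(3) r(1) by blast
        finally have "X = (I +> (c \<otimes> s)) \<otimes>\<^bsub>Q\<^esub> D" using c(1) *(2) d by simp
        then show ?thesis
          using h.hom_closed[of "c \<otimes> s"] c(1) *(2) unfolding cgenideal_def by blast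
      qed
      moreover have "X \<in> PIdl\<^bsub>Q\<^esub> (I +> e)" if "X \<otimes>\<^bsub>Q\<^esub> D = \<zero>\<^bsub>Q\<^esub>"
      proof -
        have "I +> (x \<otimes> d) = \<zero>\<^bsub>Q\<^esub>" using that x d by simp
        then obtain c where c: "c \<in> carrier R" "x \<otimes> d = c \<otimes> r"
          using zero[of "x \<otimes> d"] x(1) d(1) by blast
        then have "g \<otimes> (x \<otimes> d') = g \<otimes> (c \<otimes> e)" using x * by (simp add: m_lcomm)
        then have xc: "x \<otimes> d' = c \<otimes> e" using m_lcancel nz x c * by simp
        have "x = x \<otimes> (s \<otimes> d' \<oplus> t \<otimes> e)" using x * by simp
        also have "\<dots> = s \<otimes> (x \<otimes> d') \<oplus> (x \<otimes> t) \<otimes> e" using x(1) *(1-5) by algebra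
        also have "\<dots> = (s \<otimes> c \<oplus> x \<otimes> t) \<otimes> e" unfolding xc using c(1) x(1) *(1-5) by algebra
        finally have "X = (I +> (s \<otimes> c \<oplus> x \<otimes> t)) \<otimes>\<^bsub>Q\<^esub> (I +> e)"
          using x c(1) *(1-5) h.hom_mult[of "s \<otimes> c \<oplus> x \<otimes> t" e] by simp
        then show ?thesis
          using h.hom_closed[of "s \<otimes> c \<oplus> x \<otimes> t"] c(1) x(1) *(2,3) unfolding cgenideal_def by blast
      qed
      moreover have "X \<otimes>\<^bsub>Q\<^esub> (I +> e) = \<zero>\<^bsub>Q\<^esub>" if "X \<in> PIdl\<^bsub>Q\<^esub> D"
      proof -
        from that obtain C where "C \<in> carrier Q" "X = C \<otimes>\<^bsub>Q\<^esub> D" unfolding cgenideal_def by blast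
        then show ?thesis
          using DE d h.hom_closed[OF *(5)] h.hom_closed[OF d(1)]
          by (simp add: Q.m_assoc del: h.hom_mult)
      qed
      moreover have "X \<otimes>\<^bsub>Q\<^esub> D = \<zero>\<^bsub>Q\<^esub>" if "X \<in> PIdl\<^bsub>Q\<^esub> (I +> e)"
      proof -
        from that obtain C where "C \<in> carrier Q" "X = C \<otimes>\<^bsub>Q\<^esub> (I +> e)"
          unfolding cgenideal_def by blast
        then show ?thesis
          using DE \<open>D \<in> carrier Q\<close> h.hom_closed[OF *(5)] Q.m_comm[of D "I +> e"]
            Q.m_assoc[of C "I +> e" D] Q.r_null[of C] by simp
      qed
      ultimately show ?thesis by (intro conjI iffI)
    qed
    then show "\<exists>E\<in>carrier Q. \<forall>X\<in>carrier Q.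
        (X \<otimes>\<^bsub>Q\<^esub> E = \<zero>\<^bsub>Q\<^esub> \<longleftrightarrow> X \<in> PIdl\<^bsub>Q\<^esub> D) \<and> (X \<otimes>\<^bsub>Q\<^esub> D = \<zero>\<^bsub>Q\<^esub> \<longleftrightarrow> X \<in> PIdl\<^bsub>Q\<^esub> E)"
      using h.hom_closed[OF *(5)] by blast
  qed
  then show ?thesis by (simp add: Q_def I_def)
qed

text \<open>
  The ascending chain condition, in the form needed for induction.
\<close>

lemma (in self_dual_pir) wf_ideals_superset:
  "wf {(J, I). ideal I R \<and> ideal J R \<and> I \<subset> J}"
proof -
  have "noetherian_ring R"
  proof (rule noetherian_ringI)
    fix I assume "ideal I R"
    then obtain d where "d \<in> carrier R" "I = PIdl d" using ideal_principal by blast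
    then show "\<exists>A\<subseteq>carrier R. finite A \<and> I = Idl A"
      by (intro exI[of _ "{d}"]) (simp add: cgenideal_eq_genideal)
  qed
  then interpret noetherian_ring R .
  show ?thesis
    unfolding wf_iff_no_infinite_down_chain
  proof
    assume "\<exists>f. \<forall>i. (f (Suc i), f i) \<in> {(J, I). ideal I R \<and> ideal J R \<and> I \<subset> J}"
    then obtain f where "\<forall>i. ideal (f i) R \<and> f i \<subset> f (Suc i)"
      unfolding mem_Collect_eq case_prod_conv by blast
    then have f: "\<And>i. ideal (f i) R" "\<And>i. f i \<subset> f (Suc i)" by blast+
    have mono: "f i \<subseteq> f j" if "i \<le> j" for i j
      using lift_Suc_mono_le[of f i j] f(2) that by (meson psubset_imp_subset)
    have "\<Union>(range f) \<in> range f"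
    proof (rule ideal_chain_is_trivial)
      show "subset.chain {I. ideal I R} (range f)"
        unfolding subset_chain_def
      proof (intro conjI ballI)
        show "range f \<subseteq> {I. ideal I R}" using f(1) by blast
        show "X \<subseteq> Y \<or> Y \<subseteq> X" if XY: "X \<in> range f" "Y \<in> range f" for X Y
        proof -
          obtain i j where "X = f i" "Y = f j" using XY by blast
          then show ?thesis using mono[of i j] mono[of j i] nat_le_linear[of i j] by blast
        qed
      qed
    qed simp
    then obtain i where "\<Union>(range f) = f i" by blast
    then show False using f(2)[of i] by blast
  qed
qed

section \<open>Duality maps and coordinate changes\<close>

lemma col_eqI:
  assumes "x \<in> mats R n 1" "y \<in> mats R n 1" "\<And>k. k < n \<Longrightarrow> x $$ (k,0) = y $$ (k,0)"
  shows "x = y"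
  using assms by (intro eq_matI) (auto simp: mats_dim)

lemma mat_module_simps:
  "carrier (mat_module R m n) = mats R m n"
  "\<zero>\<^bsub>mat_module R m n\<^esub> = mat_zero R m n"
  "A \<oplus>\<^bsub>mat_module R m n\<^esub> B = mat m n (\<lambda>ij. A $$ ij \<oplus>\<^bsub>R\<^esub> B $$ ij)"
  "a \<odot>\<^bsub>mat_module R m n\<^esub> A = mat m n (\<lambda>ij. a \<otimes>\<^bsub>R\<^esub> A $$ ij)"
  by (simp_all add: mat_module_def)

context cring
begin

text \<open>
  Vectors of \<open>R\<^sup>n\<close> are \<open>n \<times> 1\<close> matrices; row vectors enter only through transposition.
\<close>

abbreviation colvec :: "nat \<Rightarrow> ('a, 'a mat) module" where
  "colvec n \<equiv> mat_module R n 1"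

text \<open>
  The standard symmetric bilinear form on \<open>R\<^sup>n\<close>.
\<close>

definition dot :: "nat \<Rightarrow> 'a mat \<Rightarrow> 'a mat \<Rightarrow> 'a" where
  "dot n x y = (\<Oplus>k \<in> {..<n}. x $$ (k,0) \<otimes> y $$ (k,0))"

text \<open>
  The orthogonal complement for \<open>dot\<close>, with both arguments columns.
\<close>

definition perp :: "nat \<Rightarrow> 'a mat set \<Rightarrow> 'a mat set" where
  "perp n N = {v \<in> mats R n 1. \<forall>x \<in> N. dot n x v = \<zero>}"

text \<open>
  A symmetric endomorphism of \<open>R\<^sup>n\<close> with kernel \<open>N\<close> and image \<open>N\<^sup>\<bottom>\<close>.
\<close>

definition duality_map :: "nat \<Rightarrow> 'a mat set \<Rightarrow> ('a mat \<Rightarrow> 'a mat) \<Rightarrow> bool" where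
  "duality_map n N \<sigma> \<longleftrightarrow>
     linear_on R (colvec n) (colvec n) \<sigma> \<and>
     (\<forall>x \<in> mats R n 1. \<forall>y \<in> mats R n 1. dot n (\<sigma> x) y = dot n x (\<sigma> y)) \<and>
     (\<forall>x \<in> mats R n 1. \<sigma> x = mat_zero R n 1 \<longleftrightarrow> x \<in> N) \<and>
     \<sigma> ` mats R n 1 = perp n N"

lemma dot_closed [intro, simp]:
  "x \<in> mats R n 1 \<Longrightarrow> y \<in> mats R n 1 \<Longrightarrow> dot n x y \<in> carrier R"
  unfolding dot_def by (intro finsum_closed) (auto simp: matsD)

lemma dot_cong:
  assumes "x \<in> mats R m 1" "y \<in> mats R m 1" "n \<le> m"
    and "\<And>k. k < n \<Longrightarrow> x $$ (k,0) = x' $$ (k,0)" "\<And>k. k < n \<Longrightarrow> y $$ (k,0) = y' $$ (k,0)"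
  shows "dot n x' y' = dot n x y"
  unfolding dot_def
  using assms(3) matsD[OF assms(1)] matsD[OF assms(2)]
  by (intro add.finprod_cong') (auto simp: assms(4,5)[symmetric])

lemma dot_Suc:
  assumes "x \<in> mats R (Suc n) 1" "y \<in> mats R (Suc n) 1"
  shows "dot (Suc n) x y = x $$ (n,0) \<otimes> y $$ (n,0) \<oplus> dot n x y"
  unfolding dot_def lessThan_Suc
  using matsD[OF assms(1)] matsD[OF assms(2)] by (intro finsum_insert) auto

lemma dot_split2:
  assumes "x \<in> mats R n 1" "y \<in> mats R n 1" "i < n" "j < n" "i \<noteq> j"
  shows "dot n x y = (x $$ (i,0) \<otimes> y $$ (i,0) \<oplus> x $$ (j,0) \<otimes> y $$ (j,0)) \<oplus>
    (\<Oplus>k \<in> {..<n} - {i,j}. x $$ (k,0) \<otimes> y $$ (k,0))"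
proof -
  define f where "f k = x $$ (k,0) \<otimes> y $$ (k,0)" for k
  have f: "f k \<in> carrier R" if "k < n" for k
    unfolding f_def using that matsD[OF assms(1)] matsD[OF assms(2)] by simp
  have e: "{..<n} = insert i (insert j ({..<n} - {i,j}))" using assms by auto
  have "(\<Oplus>k \<in> insert i (insert j ({..<n} - {i,j})). f k) = f i \<oplus> (\<Oplus>k \<in> insert j ({..<n} - {i,j}). f k)"
    using assms f by (intro finsum_insert) auto
  also have "(\<Oplus>k \<in> insert j ({..<n} - {i,j}). f k) = f j \<oplus> (\<Oplus>k \<in> {..<n} - {i,j}. f k)"
    using assms f by (intro finsum_insert) auto
  finally have "(\<Oplus>k \<in> {..<n}. f k) = f i \<oplus> (f j \<oplus> (\<Oplus>k \<in> {..<n} - {i,j}. f k))"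
    using e by simp
  also have "\<dots> = (f i \<oplus> f j) \<oplus> (\<Oplus>k \<in> {..<n} - {i,j}. f k)"
    using f assms by (intro a_assoc[symmetric] finsum_closed) auto
  finally show ?thesis unfolding dot_def f_def .
qed

text \<open>
  If \<open>\<phi>\<close> and \<open>\<psi>\<close> are adjoint automorphisms of \<open>R\<^sup>n\<close>, then a duality map \<open>\<sigma>\<close> for \<open>\<phi> N\<close> yields
  the duality map \<open>\<psi> \<sigma> \<phi>\<close> for \<open>N\<close>, because \<open>N\<^sup>\<bottom> = \<psi> ((\<phi> N)\<^sup>\<bottom>)\<close>.
\<close>

lemma duality_map_pullback:
  assumes \<phi>: "linear_on R (colvec n) (colvec n) \<phi>" "\<phi> ` mats R n 1 = mats R n 1" "inj_on \<phi> (mats R n 1)"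
    and \<psi>: "linear_on R (colvec n) (colvec n) \<psi>" "\<psi> ` mats R n 1 = mats R n 1" "inj_on \<psi> (mats R n 1)"
    and adj: "\<And>x y. x \<in> mats R n 1 \<Longrightarrow> y \<in> mats R n 1 \<Longrightarrow> dot n (\<phi> x) y = dot n x (\<psi> y)"
    and adj': "\<And>x y. x \<in> mats R n 1 \<Longrightarrow> y \<in> mats R n 1 \<Longrightarrow> dot n (\<psi> x) y = dot n x (\<phi> y)"
    and N: "N \<subseteq> mats R n 1" and \<sigma>: "duality_map n (\<phi> ` N) \<sigma>"
  shows "duality_map n N (\<lambda>x. \<psi> (\<sigma> (\<phi> x)))"
proof -
  have \<sigma>lin: "linear_on R (colvec n) (colvec n) \<sigma>"
    and sym: "\<And>x y. x \<in> mats R n 1 \<Longrightarrow> y \<in> mats R n 1 \<Longrightarrow> dot n (\<sigma> x) y = dot n x (\<sigma> y)"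
    and ker: "\<And>x. x \<in> mats R n 1 \<Longrightarrow> \<sigma> x = mat_zero R n 1 \<longleftrightarrow> x \<in> \<phi> ` N"
    and im: "\<sigma> ` mats R n 1 = perp n (\<phi> ` N)"
    using \<sigma> by (auto simp: duality_map_def)
  have cl: "\<phi> x \<in> mats R n 1" "\<psi> x \<in> mats R n 1" "\<sigma> x \<in> mats R n 1" if "x \<in> mats R n 1" for x
    using linear_onD(1)[OF \<phi>(1), of x] linear_onD(1)[OF \<psi>(1), of x] linear_onD(1)[OF \<sigma>lin, of x] that
    by (auto simp: mat_module_simps)
  have z: "mat_zero R n 1 \<in> mats R n 1" by (simp add: mat_zero_def mats_mat)
  have \<psi>z: "\<psi> (mat_zero R n 1) = mat_zero R n 1"
    using linear_on_zero[OF mat_module_module mat_module_module \<psi>(1)]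
      by (simp add: mat_module_simps)
  show ?thesis
    unfolding duality_map_def
  proof (intro conjI ballI)
    show "linear_on R (colvec n) (colvec n) (\<lambda>x. \<psi> (\<sigma> (\<phi> x)))"
      by (rule linear_on_comp[OF linear_on_comp[OF \<phi>(1) \<sigma>lin] \<psi>(1)])
  next
    fix x y assume xy: "x \<in> mats R n 1" "y \<in> mats R n 1"
    have "dot n (\<psi> (\<sigma> (\<phi> x))) y = dot n (\<sigma> (\<phi> x)) (\<phi> y)" using xy cl by (intro adj') auto
    also have "\<dots> = dot n (\<phi> x) (\<sigma> (\<phi> y))" using xy cl by (intro sym) auto
    also have "\<dots> = dot n x (\<psi> (\<sigma> (\<phi> y)))" using xy cl by (intro adj) auto
    finally show "dot n (\<psi> (\<sigma> (\<phi> x))) y = dot n x (\<psi> (\<sigma> (\<phi> y)))" .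
  next
    fix x assume x: "x \<in> mats R n 1"
    have "\<psi> (\<sigma> (\<phi> x)) = mat_zero R n 1 \<longleftrightarrow> \<sigma> (\<phi> x) = mat_zero R n 1"
      using inj_on_eq_iff[OF \<psi>(3) cl(3)[OF cl(1)[OF x]] z] \<psi>z by simp
    also have "\<dots> \<longleftrightarrow> x \<in> N"
      using ker[OF cl(1)[OF x]] inj_on_image_mem_iff[OF \<phi>(3) x N] by simp
    finally show "\<psi> (\<sigma> (\<phi> x)) = mat_zero R n 1 \<longleftrightarrow> x \<in> N" .
  next
    have "(\<lambda>x. \<psi> (\<sigma> (\<phi> x))) ` mats R n 1 = \<psi> ` \<sigma> ` \<phi> ` mats R n 1"
      by (simp only: image_image)
    also have "\<dots> = \<psi> ` perp n (\<phi> ` N)" by (simp only: \<phi>(2) im)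
    also have "\<dots> = perp n N"
    proof
      have *: "w \<in> perp n (\<phi> ` N) \<longleftrightarrow> \<psi> w \<in> perp n N" if w: "w \<in> mats R n 1" for w
        unfolding perp_def using w cl(2)[OF w] adj[OF subsetD[OF N] w] by auto
      show "\<psi> ` perp n (\<phi> ` N) \<subseteq> perp n N" using * by (auto simp: perp_def)
      show "perp n N \<subseteq> \<psi> ` perp n (\<phi> ` N)"
      proof
        fix v assume v: "v \<in> perp n N"
        then have "v \<in> \<psi> ` mats R n 1" unfolding \<psi>(2) by (simp add: perp_def)
        then obtain w where "w \<in> mats R n 1" "v = \<psi> w" by blast
        then show "v \<in> \<psi> ` perp n (\<phi> ` N)" using * v by blast
      qed
    qed
    finally show "(\<lambda>x. \<psi> (\<sigma> (\<phi> x))) ` mats R n 1 = perp n N" .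
  qed
qed

text \<open>
  For \<open>i \<noteq> j\<close>, the linear map of \<open>R\<^sup>n\<close> which acts on the coordinates \<open>i\<close> and \<open>j\<close> by the
  \<open>2 \<times> 2\<close> matrix with rows \<open>(p, q)\<close> and \<open>(s, t)\<close> and fixes the others.  It is invertible if
  that matrix has determinant 1, and its adjoint belongs to the transposed matrix.
\<close>

definition mix :: "nat \<Rightarrow> nat \<Rightarrow> nat \<Rightarrow> 'a \<Rightarrow> 'a \<Rightarrow> 'a \<Rightarrow> 'a \<Rightarrow> 'a mat \<Rightarrow> 'a mat" where
  "mix n i j p q s t x = mat n 1 (\<lambda>(k, _).
     if k = i then p \<otimes> x $$ (i,0) \<oplus> q \<otimes> x $$ (j,0)
     else if k = j then s \<otimes> x $$ (i,0) \<oplus> t \<otimes> x $$ (j,0)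
     else x $$ (k,0))"

lemma mix_index:
  assumes "k < n"
  shows "mix n i j p q s t x $$ (k,0) =
     (if k = i then p \<otimes> x $$ (i,0) \<oplus> q \<otimes> x $$ (j,0)
      else if k = j then s \<otimes> x $$ (i,0) \<oplus> t \<otimes> x $$ (j,0)
      else x $$ (k,0))"
  using assms by (simp add: mix_def)

context
  fixes n i j :: nat
  assumes ij: "i < n" "j < n" "i \<noteq> j"
begin

lemma mix_closed:
  assumes "p \<in> carrier R" "q \<in> carrier R" "s \<in> carrier R" "t \<in> carrier R" "x \<in> mats R n 1"
  shows "mix n i j p q s t x \<in> mats R n 1"
  using assms(1-4) ij matsD[OF assms(5)] unfolding mix_def mats_mat by auto

lemma mix_linear:
  assumes c: "p \<in> carrier R" "q \<in> carrier R" "s \<in> carrier R" "t \<in> carrier R"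
  shows "linear_on R (colvec n) (colvec n) (mix n i j p q s t)"
  unfolding linear_on_def mat_module_simps
proof (intro conjI ballI funcsetI)
  show "mix n i j p q s t x \<in> mats R n 1" if "x \<in> mats R n 1" for x
    using mix_closed c that by blast
next
  fix x y assume xy: "x \<in> mats R n 1" "y \<in> mats R n 1"
  note D = matsD[OF xy(1), of _ 0, simplified] matsD[OF xy(2), of _ 0, simplified]
  have *: "a \<otimes> (x $$ (i,0) \<oplus> y $$ (i,0)) \<oplus> b \<otimes> (x $$ (j,0) \<oplus> y $$ (j,0)) =
     (a \<otimes> x $$ (i,0) \<oplus> b \<otimes> x $$ (j,0)) \<oplus> (a \<otimes> y $$ (i,0) \<oplus> b \<otimes> y $$ (j,0))"
    if "a \<in> carrier R" "b \<in> carrier R" for a b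
    using that D[OF ij(1)] D[OF ij(2)] by algebra
  show "mix n i j p q s t (mat n 1 (\<lambda>ij. x $$ ij \<oplus> y $$ ij)) =
    mat n 1 (\<lambda>ij. mix n i j p q s t x $$ ij \<oplus> mix n i j p q s t y $$ ij)"
    using ij * c by (intro eq_matI) (auto simp: mix_def)
next
  fix a x assume ax: "a \<in> carrier R" "x \<in> mats R n 1"
  note D = matsD[OF ax(2), of _ 0, simplified]
  have *: "b \<otimes> (a \<otimes> x $$ (i,0)) \<oplus> c \<otimes> (a \<otimes> x $$ (j,0)) =
     a \<otimes> (b \<otimes> x $$ (i,0) \<oplus> c \<otimes> x $$ (j,0))"
    if "b \<in> carrier R" "c \<in> carrier R" for b c
    using that ax(1) D[OF ij(1)] D[OF ij(2)] by algebra
  show "mix n i j p q s t (mat n 1 (\<lambda>ij. a \<otimes> x $$ ij)) =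
    mat n 1 (\<lambda>ij. a \<otimes> mix n i j p q s t x $$ ij)"
    using ij * c by (intro eq_matI) (auto simp: mix_def)
qed

lemma mix_adjoint:
  assumes c: "p \<in> carrier R" "q \<in> carrier R" "s \<in> carrier R" "t \<in> carrier R"
    and xy: "x \<in> mats R n 1" "y \<in> mats R n 1"
  shows "dot n (mix n i j p q s t x) y = dot n x (mix n i j p s q t y)"
proof -
  note D = matsD[OF xy(1), of _ 0, simplified] matsD[OF xy(2), of _ 0, simplified]
  have rest: "(\<Oplus>k \<in> {..<n} - {i,j}. mix n i j p q s t x $$ (k,0) \<otimes> y $$ (k,0)) =
        (\<Oplus>k \<in> {..<n} - {i,j}. x $$ (k,0) \<otimes> mix n i j p s q t y $$ (k,0))"
    using D by (intro add.finprod_cong') (auto simp: mix_index)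
  have "(p \<otimes> x $$ (i,0) \<oplus> q \<otimes> x $$ (j,0)) \<otimes> y $$ (i,0) \<oplus> (s \<otimes> x $$ (i,0) \<oplus> t \<otimes> x $$ (j,0)) \<otimes> y $$ (j,0)
     = x $$ (i,0) \<otimes> (p \<otimes> y $$ (i,0) \<oplus> s \<otimes> y $$ (j,0)) \<oplus> x $$ (j,0) \<otimes> (q \<otimes> y $$ (i,0) \<oplus> t \<otimes> y $$ (j,0))"
    using c D[OF ij(1)] D[OF ij(2)] by algebra
  then show ?thesis
    unfolding dot_split2[OF mix_closed[OF c xy(1)] xy(2) ij]
      dot_split2[OF xy(1) mix_closed[OF c(1,3,2,4) xy(2)] ij] rest
    using ij by (simp add: mix_index)
qed

lemma mix_inverse:
  assumes c: "p \<in> carrier R" "q \<in> carrier R" "s \<in> carrier R" "t \<in> carrier R"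
    and det: "p \<otimes> t \<ominus> q \<otimes> s = \<one>" and x: "x \<in> mats R n 1"
  shows "mix n i j t (\<ominus> q) (\<ominus> s) p (mix n i j p q s t x) = x"
proof (rule col_eqI)
  note D = matsD[OF x, of _ 0, simplified]
  have "t \<otimes> (p \<otimes> x $$ (i,0) \<oplus> q \<otimes> x $$ (j,0)) \<oplus> \<ominus> q \<otimes> (s \<otimes> x $$ (i,0) \<oplus> t \<otimes> x $$ (j,0))
     = (p \<otimes> t \<ominus> q \<otimes> s) \<otimes> x $$ (i,0)"
    "\<ominus> s \<otimes> (p \<otimes> x $$ (i,0) \<oplus> q \<otimes> x $$ (j,0)) \<oplus> p \<otimes> (s \<otimes> x $$ (i,0) \<oplus> t \<otimes> x $$ (j,0))
     = (p \<otimes> t \<ominus> q \<otimes> s) \<otimes> x $$ (j,0)"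
    using c D[OF ij(1)] D[OF ij(2)] by algebra+
  then have "t \<otimes> (p \<otimes> x $$ (i,0) \<oplus> q \<otimes> x $$ (j,0)) \<oplus> \<ominus> q \<otimes> (s \<otimes> x $$ (i,0) \<oplus> t \<otimes> x $$ (j,0))
     = x $$ (i,0)"
    "\<ominus> s \<otimes> (p \<otimes> x $$ (i,0) \<oplus> q \<otimes> x $$ (j,0)) \<oplus> p \<otimes> (s \<otimes> x $$ (i,0) \<oplus> t \<otimes> x $$ (j,0))
     = x $$ (j,0)"
    unfolding det using D[OF ij(1)] D[OF ij(2)] by simp_all
  then show "mix n i j t (\<ominus> q) (\<ominus> s) p (mix n i j p q s t x) $$ (k,0) = x $$ (k,0)" if "k < n"
    for k
    using that ij by (auto simp: mix_index)
qed (use c x mix_closed in auto)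

lemma mix_bij:
  assumes c: "p \<in> carrier R" "q \<in> carrier R" "s \<in> carrier R" "t \<in> carrier R"
    and det: "p \<otimes> t \<ominus> q \<otimes> s = \<one>"
  shows "bij_betw (mix n i j p q s t) (mats R n 1) (mats R n 1)"
proof (rule bij_betw_byWitness[where f' = "mix n i j t (\<ominus> q) (\<ominus> s) p"])
  have "t \<otimes> p \<ominus> (\<ominus> q) \<otimes> (\<ominus> s) = p \<otimes> t \<ominus> q \<otimes> s" using c by algebra
  then have d: "t \<otimes> p \<ominus> (\<ominus> q) \<otimes> (\<ominus> s) = \<one>" using det by simp
  show "\<forall>x\<in>mats R n 1. mix n i j t (\<ominus> q) (\<ominus> s) p (mix n i j p q s t x) = x"
    using mix_inverse[OF c det] by blast
  show "\<forall>x\<in>mats R n 1. mix n i j p q s t (mix n i j t (\<ominus> q) (\<ominus> s) p x) = x"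
    using mix_inverse[of t "\<ominus> q" "\<ominus> s" p] c d by simp
qed (use c mix_closed in auto)

lemma duality_map_mix:
  assumes c: "p \<in> carrier R" "q \<in> carrier R" "s \<in> carrier R" "t \<in> carrier R"
    and det: "p \<otimes> t \<ominus> q \<otimes> s = \<one>" and N: "N \<subseteq> mats R n 1"
    and \<sigma>: "duality_map n (mix n i j p q s t ` N) \<sigma>"
  shows "duality_map n N (\<lambda>x. mix n i j p s q t (\<sigma> (mix n i j p q s t x)))"
proof -
  have "p \<otimes> t \<ominus> s \<otimes> q = \<one>" using det c by (simp add: m_comm)
  note b = mix_bij[OF c det] mix_bij[OF c(1,3,2,4) this]
  show ?thesis
    by (rule duality_map_pullback[OF mix_linear[OF c] bij_betw_imp_surj_on[OF b(1)]
        bij_betw_imp_inj_on[OF b(1)]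
        mix_linear[OF c(1,3,2,4)]
        bij_betw_imp_surj_on[OF b(2)] bij_betw_imp_inj_on[OF b(2)]
        mix_adjoint[OF c] mix_adjoint[OF c(1,3,2,4)] N \<sigma>])
qed

end

end

section \<open>Splitting off the last coordinate\<close>

context cring
begin

text \<open>
  The decomposition of \<open>R\<^bsup>n+1\<^esup>\<close> as \<open>R\<^sup>n \<times> R\<close>: \<open>snoc\<close> appends a last coordinate, which has
  index \<open>n\<close>, and \<open>trunc\<close> drops it.
\<close>

definition snoc :: "nat \<Rightarrow> 'a mat \<Rightarrow> 'a \<Rightarrow> 'a mat" where
  "snoc n y c = mat (Suc n) 1 (\<lambda>(k, _). if k < n then y $$ (k,0) else c)"

definition trunc :: "nat \<Rightarrow> 'a mat \<Rightarrow> 'a mat" where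
  "trunc n x = mat n 1 (\<lambda>ij. x $$ ij)"

lemma snoc_closed: "y \<in> mats R n 1 \<Longrightarrow> c \<in> carrier R \<Longrightarrow> snoc n y c \<in> mats R (Suc n) 1"
  unfolding snoc_def mats_mat using matsD[of y R n 1] by auto

lemma snoc_last [simp]: "snoc n y c $$ (n,0) = c"
  by (simp add: snoc_def)

lemma trunc_closed: "x \<in> mats R (Suc n) 1 \<Longrightarrow> trunc n x \<in> mats R n 1"
  unfolding trunc_def mats_mat using matsD[of x R "Suc n" 1] by auto

lemma trunc_snoc: "y \<in> mats R n 1 \<Longrightarrow> trunc n (snoc n y c) = y"
  by (rule eq_matI) (auto simp: trunc_def snoc_def mats_dim)

lemma snoc_trunc: "x \<in> mats R (Suc n) 1 \<Longrightarrow> snoc n (trunc n x) (x $$ (n,0)) = x"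
  by (rule eq_matI) (auto simp: trunc_def snoc_def mats_dim less_Suc_eq)

lemma trunc_linear: "linear_on R (colvec (Suc n)) (colvec n) (trunc n)"
  unfolding linear_on_def mat_module_simps using trunc_closed
  by (auto simp: trunc_def mats_dim intro!: eq_matI)

lemma snoc_add:
  "snoc n (y \<oplus>\<^bsub>colvec n\<^esub> y') (c \<oplus> c') = snoc n y c \<oplus>\<^bsub>colvec (Suc n)\<^esub> snoc n y' c'"
  unfolding mat_module_simps by (rule eq_matI) (auto simp: snoc_def)

lemma snoc_smult:
  "snoc n (a \<odot>\<^bsub>colvec n\<^esub> y) (a \<otimes> c) = a \<odot>\<^bsub>colvec (Suc n)\<^esub> snoc n y c"
  unfolding mat_module_simps by (rule eq_matI) (auto simp: snoc_def)

lemma snoc_zero: "snoc n (mat_zero R n 1) \<zero> = mat_zero R (Suc n) 1"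
  by (rule eq_matI) (auto simp: snoc_def mat_zero_def)

lemma zero_mats: "mat_zero R m n \<in> mats R m n"
  by (simp add: mat_zero_def mats_mat)

lemma dot_trunc:
  assumes "x \<in> mats R (Suc n) 1" "y \<in> mats R (Suc n) 1"
  shows "dot (Suc n) x y = x $$ (n,0) \<otimes> y $$ (n,0) \<oplus> dot n (trunc n x) (trunc n y)"
proof -
  have "dot n (trunc n x) (trunc n y) = dot n x y"
    using assms by (intro dot_cong[where m = "Suc n"]) (auto simp: trunc_def)
  then show ?thesis using dot_Suc[OF assms] by simp
qed

lemma dot_zero_left: "y \<in> mats R n 1 \<Longrightarrow> dot n (mat_zero R n 1) y = \<zero>"
  unfolding dot_def mat_zero_def
  using matsD[of y R n 1] by (intro add.finprod_one_eqI) auto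

text \<open>
  If \<open>N\<close> contains \<open>(0, d)\<close> and all its last coordinates lie in \<open>dR\<close>, then \<open>N = N' \<times> dR\<close> and
  \<open>N\<^sup>\<bottom> = N'\<^sup>\<bottom> \<times> eR\<close>, where \<open>N'\<close> is the set of \<open>y\<close> with \<open>(y, 0) \<in> N\<close>, \<open>Ann(e) = dR\<close> and
  \<open>Ann(d) = eR\<close>.  Hence the direct sum of a duality map for \<open>N'\<close> and multiplication by \<open>e\<close> is
  a duality map for \<open>N\<close>.
\<close>

lemma duality_map_snoc:
  assumes N: "submodule N R (colvec (Suc n))"
    and d: "d \<in> carrier R" "snoc n (mat_zero R n 1) d \<in> N"
    and last: "\<And>x. x \<in> N \<Longrightarrow> x $$ (n,0) \<in> PIdl d"
    and e: "e \<in> carrier R" "\<And>x. x \<in> carrier R \<Longrightarrow> x \<otimes> e = \<zero> \<longleftrightarrow> x \<in> PIdl d"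
      "\<And>x. x \<in> carrier R \<Longrightarrow> x \<otimes> d = \<zero> \<longleftrightarrow> x \<in> PIdl e"
    and \<tau>: "duality_map n {y \<in> mats R n 1. snoc n y \<zero> \<in> N} \<tau>"
  shows "duality_map (Suc n) N (\<lambda>x. snoc n (\<tau> (trunc n x)) (e \<otimes> x $$ (n,0)))"
proof -
  interpret V: module R "colvec (Suc n)" by (rule mat_module_module)
  interpret W: module R "colvec n" by (rule mat_module_module)
  define N' where "N' = {y \<in> mats R n 1. snoc n y \<zero> \<in> N}"
  define \<sigma> where "\<sigma> x = snoc n (\<tau> (trunc n x)) (e \<otimes> x $$ (n,0))" for x
  note ND = V.submoduleE[OF N, unfolded mat_module_simps(1)]
  have \<tau>lin: "linear_on R (colvec n) (colvec n) \<tau>"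
    and sym: "\<And>x y. x \<in> mats R n 1 \<Longrightarrow> y \<in> mats R n 1 \<Longrightarrow> dot n (\<tau> x) y = dot n x (\<tau> y)"
    and ker: "\<And>x. x \<in> mats R n 1 \<Longrightarrow> \<tau> x = mat_zero R n 1 \<longleftrightarrow> x \<in> N'"
    and im: "\<tau> ` mats R n 1 = perp n N'"
    using \<tau> unfolding duality_map_def N'_def by blast+
  have \<tau>cl: "\<tau> y \<in> mats R n 1" if "y \<in> mats R n 1" for y
    using linear_onD(1)[OF \<tau>lin] that by (simp add: mat_module_simps)
  have lastc: "x $$ (n,0) \<in> carrier R" if "x \<in> mats R (Suc n) 1" for x
    using matsD[OF that, of n 0] by simp
  note tc = trunc_closed
  have \<sigma>cl: "\<sigma> x \<in> mats R (Suc n) 1" if "x \<in> mats R (Suc n) 1" for x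
    unfolding \<sigma>_def using that e(1) by (intro snoc_closed \<tau>cl tc m_closed lastc)
  have mem: "x \<in> N \<longleftrightarrow> trunc n x \<in> N' \<and> x $$ (n,0) \<in> PIdl d" if x: "x \<in> mats R (Suc n) 1" for x
  proof -
    let ?y = "trunc n x" and ?c = "x $$ (n,0)"
    note y = tc[OF x] and c = lastc[OF x]
      have shift:
      "snoc n ?y (c1 \<oplus> b \<otimes> d) = snoc n ?y c1 \<oplus>\<^bsub>colvec (Suc n)\<^esub> b \<odot>\<^bsub>colvec (Suc n)\<^esub> snoc n (mat_zero R n 1) d"
      if "b \<in> carrier R" "c1 \<in> carrier R" for b c1
    proof -
      have "?y \<oplus>\<^bsub>colvec n\<^esub> b \<odot>\<^bsub>colvec n\<^esub> \<zero>\<^bsub>colvec n\<^esub> = ?y"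
        using W.smult_r_null[OF that(1)] W.M.r_zero[of ?y] y by (simp only: mat_module_simps(1))
      then show ?thesis
        unfolding snoc_smult[symmetric] snoc_add[symmetric] by (simp only: mat_module_simps(2))
    qed
    have "snoc n ?y \<zero> \<in> N \<longleftrightarrow> x \<in> N" if "?c \<in> PIdl d"
    proof -
      obtain b where b: "b \<in> carrier R" "?c = b \<otimes> d"
        using \<open>?c \<in> PIdl d\<close> unfolding cgenideal_def by blast
      have "snoc n ?y ?c = snoc n ?y \<zero> \<oplus>\<^bsub>colvec (Suc n)\<^esub> b \<odot>\<^bsub>colvec (Suc n)\<^esub> snoc n (mat_zero R n 1) d"
        using shift[of b \<zero>] b d(1) by simp
      moreover have "?c \<oplus> (\<ominus> b) \<otimes> d = \<zero>"
        using b d(1) by (simp add: l_minus r_neg)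
      then have "snoc n ?y \<zero> = snoc n ?y ?c \<oplus>\<^bsub>colvec (Suc n)\<^esub> (\<ominus> b) \<odot>\<^bsub>colvec (Suc n)\<^esub> snoc n (mat_zero R n 1) d"
        using shift[of "\<ominus> b" ?c] b c by simp
      ultimately show ?thesis
        unfolding snoc_trunc[OF x]
          using ND(4)[OF b(1) d(2)] ND(4)[OF a_inv_closed[OF b(1)] d(2)] ND(5) by metis
    qed
    then show ?thesis using last[of x] y unfolding N'_def by blast
  qed
  have dual: "v \<in> perp (Suc n) N \<longleftrightarrow> trunc n v \<in> perp n N' \<and> v $$ (n,0) \<in> PIdl e"
    if v: "v \<in> mats R (Suc n) 1" for v
  proof
    assume "v \<in> perp (Suc n) N"
    then have p: "dot (Suc n) x v = \<zero>" if "x \<in> N" for x using that by (simp add: perp_def)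
    have "dot n y (trunc n v) = \<zero>" if "y \<in> N'" for y
    proof -
      from that have y: "y \<in> mats R n 1" "snoc n y \<zero> \<in> N" by (auto simp: N'_def)
      have "dot (Suc n) (snoc n y \<zero>) v = dot n y (trunc n v)"
        using dot_trunc[OF snoc_closed[OF y(1) zero_closed] v] trunc_snoc[OF y(1)] y(1) tc[OF v] lastc[OF v]
        by (simp del: One_nat_def)
      then show ?thesis using p[OF y(2)] by simp
    qed
    moreover have "dot (Suc n) (snoc n (mat_zero R n 1) d) v = v $$ (n,0) \<otimes> d"
      using dot_trunc[OF snoc_closed[OF zero_mats d(1)] v] trunc_snoc[OF zero_mats]
          dot_zero_left[OF tc[OF v]] lastc[OF v] d(1)
      by (simp add: m_comm del: One_nat_def)
    ultimately show "trunc n v \<in> perp n N' \<and> v $$ (n,0) \<in> PIdl e"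
      using p[OF d(2)] e(3)[OF lastc[OF v]] tc[OF v] by (simp add: perp_def)
  next
    assume a: "trunc n v \<in> perp n N' \<and> v $$ (n,0) \<in> PIdl e"
    have "dot (Suc n) x v = \<zero>" if "x \<in> N" for x
    proof -
      have x: "x \<in> mats R (Suc n) 1" using that ND(1) by blast
      have x': "trunc n x \<in> N'" "x $$ (n,0) \<in> PIdl d" using mem[OF x] that by auto
      then obtain b where b: "b \<in> carrier R" "x $$ (n,0) = b \<otimes> d" unfolding cgenideal_def by blast
      have "v $$ (n,0) \<otimes> d = \<zero>" using a e(3)[OF lastc[OF v]] by simp
      then have "x $$ (n,0) \<otimes> v $$ (n,0) = \<zero>"
        unfolding b(2) using b(1) d(1) lastc[OF v] by (simp add: m_assoc m_comm[of d])
      moreover have "dot n (trunc n x) (trunc n v) = \<zero>" using a x' by (simp add: perp_def)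
      ultimately show ?thesis using dot_trunc[OF x v] by simp
    qed
    then show "v \<in> perp (Suc n) N" using v by (simp add: perp_def)
  qed
  have "duality_map (Suc n) N \<sigma>"
    unfolding duality_map_def
  proof (intro conjI ballI)
    show "linear_on R (colvec (Suc n)) (colvec (Suc n)) \<sigma>"
      unfolding linear_on_def
    proof (intro conjI ballI funcsetI)
      show "\<sigma> x \<in> carrier (colvec (Suc n))" if "x \<in> carrier (colvec (Suc n))" for x
        using that \<sigma>cl by (simp add: mat_module_simps)
    next
      fix x y assume xy: "x \<in> carrier (colvec (Suc n))" "y \<in> carrier (colvec (Suc n))"
      have "(x \<oplus>\<^bsub>colvec (Suc n)\<^esub> y) $$ (n,0) = x $$ (n,0) \<oplus> y $$ (n,0)"
        by (simp add: mat_module_simps)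
      moreover have "\<tau> (trunc n (x \<oplus>\<^bsub>colvec (Suc n)\<^esub> y)) = \<tau> (trunc n x) \<oplus>\<^bsub>colvec n\<^esub> \<tau> (trunc n y)"
        using linear_onD(2)[OF linear_on_comp[OF trunc_linear \<tau>lin]] xy by blast
      ultimately show "\<sigma> (x \<oplus>\<^bsub>colvec (Suc n)\<^esub> y) = \<sigma> x \<oplus>\<^bsub>colvec (Suc n)\<^esub> \<sigma> y"
        unfolding \<sigma>_def snoc_add[symmetric]
          using xy e(1) lastc by (simp add: r_distr mat_module_simps(1))
    next
      fix a x assume ax: "a \<in> carrier R" "x \<in> carrier (colvec (Suc n))"
      have "(a \<odot>\<^bsub>colvec (Suc n)\<^esub> x) $$ (n,0) = a \<otimes> x $$ (n,0)"
        by (simp add: mat_module_simps)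
      moreover have "\<tau> (trunc n (a \<odot>\<^bsub>colvec (Suc n)\<^esub> x)) = a \<odot>\<^bsub>colvec n\<^esub> \<tau> (trunc n x)"
        using linear_onD(3)[OF linear_on_comp[OF trunc_linear \<tau>lin]] ax by blast
      ultimately show "\<sigma> (a \<odot>\<^bsub>colvec (Suc n)\<^esub> x) = a \<odot>\<^bsub>colvec (Suc n)\<^esub> \<sigma> x"
        unfolding \<sigma>_def snoc_smult[symmetric]
          using ax e(1) lastc by (simp add: m_lcomm mat_module_simps(1))
    qed
  next
    fix x y assume xy: "x \<in> mats R (Suc n) 1" "y \<in> mats R (Suc n) 1"
    have "trunc n (\<sigma> x) = \<tau> (trunc n x)" "trunc n (\<sigma> y) = \<tau> (trunc n y)"
      unfolding \<sigma>_def using xy by (auto intro!: trunc_snoc \<tau>cl tc)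
    then show "dot (Suc n) (\<sigma> x) y = dot (Suc n) x (\<sigma> y)"
      using dot_trunc[OF \<sigma>cl[OF xy(1)] xy(2)] dot_trunc[OF xy(1) \<sigma>cl[OF xy(2)]]
        sym[OF tc[OF xy(1)] tc[OF xy(2)]]
        lastc[OF xy(1)] lastc[OF xy(2)] e(1)
      by (simp add: \<sigma>_def m_ac)
  next
    fix x assume x: "x \<in> mats R (Suc n) 1"
    have "\<sigma> x = mat_zero R (Suc n) 1 \<longleftrightarrow> \<tau> (trunc n x) = mat_zero R n 1 \<and> e \<otimes> x $$ (n,0) = \<zero>"
      unfolding \<sigma>_def snoc_zero[symmetric]
      by (metis snoc_last trunc_snoc \<tau>cl tc x zero_mats)
    then show "\<sigma> x = mat_zero R (Suc n) 1 \<longleftrightarrow> x \<in> N"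
      using mem[OF x] ker[OF tc[OF x]] e(2)[OF lastc[OF x]] m_comm[OF e(1) lastc[OF x]] by simp
  next
    show "\<sigma> ` mats R (Suc n) 1 = perp (Suc n) N"
    proof
      show "\<sigma> ` mats R (Suc n) 1 \<subseteq> perp (Suc n) N"
      proof (rule image_subsetI)
        fix x assume x: "x \<in> mats R (Suc n) 1"
        have "trunc n (\<sigma> x) = \<tau> (trunc n x)" "\<sigma> x $$ (n,0) = x $$ (n,0) \<otimes> e"
          unfolding \<sigma>_def using x lastc e(1) by (auto intro!: trunc_snoc \<tau>cl tc m_comm)
        then show "\<sigma> x \<in> perp (Suc n) N"
          unfolding dual[OF \<sigma>cl[OF x]] using im tc[OF x] lastc[OF x] by (auto simp: cgenideal_def)
      qed
      show "perp (Suc n) N \<subseteq> \<sigma> ` mats R (Suc n) 1"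
      proof
        fix v assume v: "v \<in> perp (Suc n) N"
        then have vc: "v \<in> mats R (Suc n) 1" by (simp add: perp_def)
        then have "trunc n v \<in> \<tau> ` mats R n 1" "v $$ (n,0) \<in> PIdl e" using dual v im by auto
        then obtain y c
          where y: "y \<in> mats R n 1" "trunc n v = \<tau> y" "c \<in> carrier R" "v $$ (n,0) = c \<otimes> e"
          unfolding cgenideal_def by blast
        have "\<sigma> (snoc n y c) = snoc n (trunc n v) (v $$ (n,0))"
          unfolding \<sigma>_def using y e(1) by (simp add: trunc_snoc m_comm del: One_nat_def)
        also have "\<dots> = v" by (rule snoc_trunc[OF vc])
        finally show "v \<in> \<sigma> ` mats R (Suc n) 1" using snoc_closed[OF y(1,3)] by force
      qed
    qed
  qed
  then show ?thesis by (simp only: \<sigma>_def[abs_def])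
qed

lemma duality_map_0:
  assumes "submodule N R (colvec 0)"
  shows "duality_map 0 N (\<lambda>x. x)"
proof -
  interpret V: module R "colvec 0" by (rule mat_module_module)
  have z: "x = mat_zero R 0 1" if "x \<in> mats R 0 1" for x
    using that by (intro eq_matI) (auto simp: mats_dim mat_zero_def)
  have "N = {mat_zero R 0 1}"
    using V.submoduleE(1,2)[OF assms] z by (auto simp: mat_module_simps)
  moreover have "dot 0 x y = \<zero>" for x y by (simp add: dot_def)
  ultimately show ?thesis
    using z by (auto simp: duality_map_def linear_on_def perp_def)
qed

lemma last_coord_ideal:
  assumes N: "submodule N R (colvec (Suc n))"
  shows "ideal ((\<lambda>x. x $$ (n,0)) ` N) R"
proof (rule idealI[OF ring_axioms])
  interpret V: module R "colvec (Suc n)" by (rule mat_module_module)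
  note ND = V.submoduleE[OF N, unfolded mat_module_simps(1)]
  have c: "x $$ (n,0) \<in> carrier R" if "x \<in> N" for x
    using matsD[OF subsetD[OF ND(1) that], of n 0] by simp
  have add: "x $$ (n,0) \<oplus> y $$ (n,0) \<in> (\<lambda>x. x $$ (n,0)) ` N" if "x \<in> N" "y \<in> N" for x y
    using ND(5)[OF that] by (intro image_eqI) (auto simp: mat_module_simps)
  have smult: "a \<otimes> x $$ (n,0) \<in> (\<lambda>x. x $$ (n,0)) ` N" if "a \<in> carrier R" "x \<in> N" for a x
    using ND(4)[OF that] by (intro image_eqI) (auto simp: mat_module_simps)
  show "subgroup ((\<lambda>x. x $$ (n,0)) ` N) (add_monoid R)"
  proof (rule add.subgroupI)
    fix a assume "a \<in> (\<lambda>x. x $$ (n,0)) ` N"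
    then obtain x where x: "x \<in> N" "a = x $$ (n,0)" by blast
    have "\<ominus> a = (\<ominus> \<one>) \<otimes> x $$ (n,0)" using c x by (simp add: l_minus)
    then show "\<ominus> a \<in> (\<lambda>x. x $$ (n,0)) ` N" using smult[of "\<ominus> \<one>" x] x by simp
  qed (use c ND(2) add in auto)
  fix a b assume ab: "a \<in> (\<lambda>x. x $$ (n,0)) ` N" "b \<in> carrier R"
  then show "b \<otimes> a \<in> (\<lambda>x. x $$ (n,0)) ` N" using smult by blast
  moreover have "a \<otimes> b = b \<otimes> a" using ab c by (auto simp: m_comm)
  ultimately show "a \<otimes> b \<in> (\<lambda>x. x $$ (n,0)) ` N" by simp
qed

end

section \<open>Existence of duality maps\<close>

context self_dual_pir
begin

text \<open>
  The outer induction is on the ideal of last coordinates of \<open>N\<close>, which may grow.  While it stays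
  equal to \<open>dR\<close>, the inner induction is on the number of nonzero coordinates, apart from the
  last one, of a vector \<open>z \<in> M\<close> with last coordinate \<open>d\<close>.
\<close>

lemma duality_map_exists_Suc:
  assumes IH: "\<And>N. submodule N R (colvec n) \<Longrightarrow> \<exists>\<sigma>. duality_map n N \<sigma>"
    and N: "submodule N R (colvec (Suc n))"
  shows "\<exists>\<sigma>. duality_map (Suc n) N \<sigma>"
  using N
proof (induction "(\<lambda>x. x $$ (n,0)) ` N" arbitrary: N rule: wf_induct_rule[OF wf_ideals_superset])
  case (1 N)
  interpret V: module R "colvec (Suc n)" by (rule mat_module_module)
  define last where "last N = (\<lambda>x :: 'a mat. x $$ (n,0)) ` N" for N
  have larger: "\<exists>\<sigma>. duality_map (Suc n) M \<sigma>"
    if "submodule M R (colvec (Suc n))" "last N \<subset> last M" for M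
    using 1(1)[of M] that last_coord_ideal[OF that(1)] last_coord_ideal[OF 1(2)]
      by (auto simp: last_def)
  obtain d where d: "d \<in> carrier R" "last N = PIdl d"
    using ideal_principal[OF last_coord_ideal[OF 1(2)]] unfolding last_def by blast
  have main: "\<exists>\<sigma>. duality_map (Suc n) M \<sigma>"
    if "submodule M R (colvec (Suc n))" "last M = PIdl d" "z \<in> M" "z $$ (n,0) = d" for M z
    using that
  proof (induction "card {i. i < n \<and> z $$ (i,0) \<noteq> \<zero>}" arbitrary: M z rule: less_induct)
    case less
    note M = less.prems(1)
    have Msub: "M \<subseteq> mats R (Suc n) 1" using V.submoduleE(1)[OF M] by (simp only: mat_module_simps)
    then have z: "z \<in> mats R (Suc n) 1" using less.prems(3) by blast
    have zc: "z $$ (k,0) \<in> carrier R" if "k < Suc n" for k using matsD[OF z that] by simp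
    have img: "submodule (mix (Suc n) i n p q s t ` M) R (colvec (Suc n))"
      and pull: "\<exists>\<sigma>. duality_map (Suc n) (mix (Suc n) i n p q s t ` M) \<sigma> \<Longrightarrow> \<exists>\<sigma>. duality_map (Suc n) M \<sigma>"
      if i: "i < n" and c: "p \<in> carrier R" "q \<in> carrier R" "s \<in> carrier R" "t \<in> carrier R"
        and det: "p \<otimes> t \<ominus> q \<otimes> s = \<one>" for i p q s t
    proof -
      have ij: "i < Suc n" "n < Suc n" "i \<noteq> n" using i by auto
      show "submodule (mix (Suc n) i n p q s t ` M) R (colvec (Suc n))"
       
          by (rule linear_on_image_submodule[OF mat_module_module mat_module_module mix_linear[OF ij c] M])
      show "\<exists>\<sigma>. duality_map (Suc n) M \<sigma>" if "\<exists>\<sigma>. duality_map (Suc n) (mix (Suc n) i n p q s t ` M) \<sigma>"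
        using duality_map_mix[OF ij c det Msub] that by blast
    qed
    show ?case
    proof (cases "\<exists>i<n. z $$ (i,0) \<noteq> \<zero>")
      case False
      have "z = snoc n (mat_zero R n 1) d"
        using False less.prems(4) z
        by (intro eq_matI) (auto simp: snoc_def mat_zero_def mats_dim less_Suc_eq)
      then have zd: "snoc n (mat_zero R n 1) d \<in> M" using less.prems(3) by simp
      obtain e where e: "e \<in> carrier R" "\<And>x. x \<in> carrier R \<Longrightarrow> x \<otimes> e = \<zero> \<longleftrightarrow> x \<in> PIdl d"
        "\<And>x. x \<in> carrier R \<Longrightarrow> x \<otimes> d = \<zero> \<longleftrightarrow> x \<in> PIdl e"
        using dual_annihilator[OF d(1)] by blast
      interpret W: module R "colvec n" by (rule mat_module_module)
      note MD = V.submoduleE[OF M]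
      have "submodule {y \<in> mats R n 1. snoc n y \<zero> \<in> M} R (colvec n)"
      proof (rule W.submoduleI_add_smult)
        show "\<zero>\<^bsub>colvec n\<^esub> \<in> {y \<in> mats R n 1. snoc n y \<zero> \<in> M}"
          using submodule_zero_closed[OF M] zero_mats snoc_zero by (simp add: mat_module_simps)
        show "x \<oplus>\<^bsub>colvec n\<^esub> y \<in> {y \<in> mats R n 1. snoc n y \<zero> \<in> M}"
          if "x \<in> {y \<in> mats R n 1. snoc n y \<zero> \<in> M}" "y \<in> {y \<in> mats R n 1. snoc n y \<zero> \<in> M}" for x y
        proof -
          have "snoc n (x \<oplus>\<^bsub>colvec n\<^esub> y) \<zero> \<in> M" using MD(5) that snoc_add[of n x y \<zero> \<zero>] by simp
          moreover have "x \<oplus>\<^bsub>colvec n\<^esub> y \<in> mats R n 1"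
            using W.M.a_closed[of x y] that by (simp only: mat_module_simps(1) mem_Collect_eq)
          ultimately show ?thesis by blast
        qed
        show "a \<odot>\<^bsub>colvec n\<^esub> x \<in> {y \<in> mats R n 1. snoc n y \<zero> \<in> M}"
          if "a \<in> carrier R" "x \<in> {y \<in> mats R n 1. snoc n y \<zero> \<in> M}" for a x
        proof -
          have "snoc n (a \<odot>\<^bsub>colvec n\<^esub> x) \<zero> \<in> M" using MD(4) that snoc_smult[of n a x \<zero>] by simp
          moreover have "a \<odot>\<^bsub>colvec n\<^esub> x \<in> mats R n 1"
            using W.smult_closed[of a x] that by (simp only: mat_module_simps(1) mem_Collect_eq)
          ultimately show ?thesis by blast
        qed
      qed (auto simp: mat_module_simps)
      then obtain \<tau> where "duality_map n {y \<in> mats R n 1. snoc n y \<zero> \<in> M} \<tau>" using IH by blast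
      moreover have "x $$ (n,0) \<in> PIdl d" if "x \<in> M" for x
        using less.prems(2) that by (auto simp: last_def)
      ultimately show ?thesis using duality_map_snoc[OF M d(1) zd _ e] by blast
    next
      case True
      then obtain i where i: "i < n" "z $$ (i,0) \<noteq> \<zero>" by blast
      define a where "a = z $$ (i,0)"
      have a: "a \<in> carrier R" unfolding a_def using zc i(1) by simp
      show ?thesis
      proof (cases "a \<in> PIdl d")
        case True
        then obtain c where c: "c \<in> carrier R" "a = c \<otimes> d" unfolding cgenideal_def by blast
        \<comment> \<open>A shear that replaces \<open>a = c d\<close> by \<open>a - c d = 0\<close> and keeps all last coordinates.\<close>
        define \<phi> where "\<phi> = mix (Suc n) i n \<one> (\<ominus> c) \<zero> \<one>"
        have det: "\<one> \<otimes> \<one> \<ominus> (\<ominus> c) \<otimes> \<zero> = \<one>" using c(1) by algebra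
        note coeffs = i(1) one_closed a_inv_closed[OF c(1)] zero_closed one_closed det
        have lastx: "\<phi> x $$ (n,0) = x $$ (n,0)" if "x \<in> mats R (Suc n) 1" for x
          using matsD[OF that, of i 0] matsD[OF that, of n 0] i(1) by (simp add: \<phi>_def mix_index)
        have "\<phi> z $$ (i,0) = \<zero>"
          using i(1) c d(1) less.prems(4)
            by (simp add: \<phi>_def mix_index a_def[symmetric] l_minus r_neg)
        moreover have "\<phi> z $$ (k,0) = z $$ (k,0)" if "k < n" "k \<noteq> i" for k
          using that by (simp add: \<phi>_def mix_index)
        ultimately have "{k. k < n \<and> \<phi> z $$ (k,0) \<noteq> \<zero>} \<subset> {k. k < n \<and> z $$ (k,0) \<noteq> \<zero>}"
          using i by (auto simp: psubset_eq) metis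
        then have card: "card {k. k < n \<and> \<phi> z $$ (k,0) \<noteq> \<zero>} < card {k. k < n \<and> z $$ (k,0) \<noteq> \<zero>}"
          by (intro psubset_card_mono) auto
        have "last (\<phi> ` M) = last M"
          unfolding last_def image_image using lastx Msub by (intro image_cong) auto
        then have "\<exists>\<sigma>. duality_map (Suc n) (\<phi> ` M) \<sigma>"
          using less.prems(2-4) lastx[OF z] img[OF coeffs]
            by (intro less.hyps[OF card]) (auto simp: \<phi>_def)
        then show ?thesis unfolding \<phi>_def by (rule pull[OF coeffs])
      next
        case False
        obtain g s t a' d'
          where b: "g \<in> carrier R" "s \<in> carrier R" "t \<in> carrier R" "a' \<in> carrier R" "d' \<in> carrier R"
          and eq: "a = g \<otimes> a'" "d = g \<otimes> d'" "s \<otimes> a' \<oplus> t \<otimes> d' = \<one>"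
          using cofactors[OF a d(1)] by blast
        \<comment> \<open>This sends the pair \<open>(a, d)\<close> of coordinates of \<open>z\<close>
            to \<open>(0, g)\<close>, and \<open>gR\<close> properly contains \<open>dR\<close>.\<close>
        define \<phi> where "\<phi> = mix (Suc n) i n d' (\<ominus> a') s t"
        have "d' \<otimes> t \<ominus> (\<ominus> a') \<otimes> s = s \<otimes> a' \<oplus> t \<otimes> d'" using b by algebra
        then have det: "d' \<otimes> t \<ominus> (\<ominus> a') \<otimes> s = \<one>" using eq(3) by simp
        note coeffs = i(1) b(5) a_inv_closed[OF b(4)] b(2,3) det
        have sub: "submodule (\<phi> ` M) R (colvec (Suc n))" unfolding \<phi>_def by (rule img[OF coeffs])
        have "\<phi> z $$ (n,0) = s \<otimes> a \<oplus> t \<otimes> d"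
          using i(1) less.prems(4) by (simp add: \<phi>_def mix_index a_def)
        also have "\<dots> = g \<otimes> (s \<otimes> a' \<oplus> t \<otimes> d')" unfolding eq(1,2) using b by algebra
        finally have "\<phi> z $$ (n,0) = g" using eq(3) b(1) by simp
        then have "g \<in> last (\<phi> ` M)" unfolding last_def using less.prems(3) by force
        moreover have "ideal (last (\<phi> ` M)) R"
          unfolding last_def by (rule last_coord_ideal[OF sub])
        ultimately have "PIdl g \<subseteq> last (\<phi> ` M)" by (intro cgenideal_minimal)
        moreover have gm: "a \<in> PIdl g" "d \<in> PIdl g"
          using b eq(1,2) by (auto simp: cgenideal_def m_comm)
        have "PIdl d \<subseteq> PIdl g"
          using gm(2) cgenideal_ideal[OF b(1)] by (intro cgenideal_minimal)
        ultimately have "last N \<subset> last (\<phi> ` M)" using gm(1) False unfolding d(2) by blast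
        then have "\<exists>\<sigma>. duality_map (Suc n) (\<phi> ` M) \<sigma>" by (rule larger[OF sub])
        then show ?thesis unfolding \<phi>_def by (rule pull[OF coeffs])
      qed
    qed
  qed
  have "d \<in> last N" unfolding d(2) using d(1) by (rule cgenideal_self)
  then obtain z where "z \<in> N" "z $$ (n,0) = d" unfolding last_def by blast
  then show ?case using main[OF 1(2) d(2)] by blast
qed

theorem duality_map_exists:
  "submodule N R (colvec n) \<Longrightarrow> \<exists>\<sigma>. duality_map n N \<sigma>"
proof (induction n arbitrary: N)
  case 0
  then show ?case using duality_map_0 by blast
next
  case (Suc n)
  show ?case by (rule duality_map_exists_Suc[OF Suc])
qed

end

section \<open>Row and column spaces\<close>

lemma transpose_mats: "A \<in> mats R m n \<Longrightarrow> transpose_mat A \<in> mats R n m"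
  using matsD[of A R m n] mats_dim[of A R m n] unfolding transpose_mat_def by (simp add: mats_mat)

lemma transpose_image_iff:
  "transpose_mat x \<in> transpose_mat ` X \<longleftrightarrow> x \<in> X"
  using inj_image_mem_iff[of transpose_mat x X] by (metis image_iff transpose_transpose)

lemma transpose_linear:
  "linear_on R (mat_module R m n) (mat_module R n m) transpose_mat"
  unfolding linear_on_def mat_module_simps using transpose_mats
  by (auto simp: mats_dim intro!: eq_matI)

context cring
begin

lemma mat_mult_mats:
  assumes "A \<in> mats R m n" "B \<in> mats R n l"
  shows "mat_mult R A B \<in> mats R m l"
  using assms matsD[OF assms(1)] matsD[OF assms(2)]
  by (auto simp: mat_mult_def mats_mat mats_dim intro!: finsum_closed)

lemma transpose_mat_mult:
  assumes "A \<in> mats R m n" "B \<in> mats R n l"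
  shows "transpose_mat (mat_mult R A B) = mat_mult R (transpose_mat B) (transpose_mat A)"
proof (rule eq_matI)
  note dims = mats_dim[OF assms(1)] mats_dim[OF assms(2)]
  fix i j assume "i < dim_row (mat_mult R (transpose_mat B) (transpose_mat A))"
    "j < dim_col (mat_mult R (transpose_mat B) (transpose_mat A))"
  then have ij: "i < l" "j < m" using dims by (auto simp: mat_mult_def)
  have "(\<Oplus>k\<in>{..<n}. A $$ (j,k) \<otimes> B $$ (k,i)) =
      (\<Oplus>k\<in>{..<n}. transpose_mat B $$ (i,k) \<otimes> transpose_mat A $$ (k,j))"
    using ij dims matsD[OF assms(1)] matsD[OF assms(2)]
    by (intro add.finprod_cong') (auto simp: m_comm)
  then show "transpose_mat (mat_mult R A B) $$ (i,j) =
      mat_mult R (transpose_mat B) (transpose_mat A) $$ (i,j)"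
    using ij dims by (simp add: mat_mult_def)
qed (auto simp: mat_mult_def)

lemma mat_mult_row_col:
  assumes "x \<in> mats R 1 n" "v \<in> mats R n 1"
  shows "mat_mult R x v = mat 1 1 (\<lambda>_. dot n (transpose_mat x) v)"
proof (rule eq_matI)
  fix i j assume "i < dim_row (mat 1 1 (\<lambda>_. dot n (transpose_mat x) v))" "j < dim_col (mat 1 1 (\<lambda>_. dot n (transpose_mat x) v))"
  then have ij: "i = 0" "j = 0" by auto
  have "(\<Oplus>k\<in>{..<n}. x $$ (0,k) \<otimes> v $$ (k,0)) = dot n (transpose_mat x) v"
    unfolding dot_def using mats_dim[OF assms(1)] matsD[OF assms(1)] matsD[OF assms(2)]
    by (intro add.finprod_cong') auto
  then show "mat_mult R x v $$ (i,j) = mat 1 1 (\<lambda>_. dot n (transpose_mat x) v) $$ (i,j)"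
    using ij assms by (simp add: mat_mult_def mats_dim)
qed (use assms in \<open>auto simp: mat_mult_def mats_dim\<close>)

lemma Row_subset: "A \<in> mats R m n \<Longrightarrow> Row R A \<subseteq> mats R 1 n"
  using mat_mult_mats by (auto simp: Row_def mats_dim)

lemma orth_compl_eq_perp:
  assumes "X \<subseteq> mats R 1 n"
  shows "orth_compl R n X = perp n (transpose_mat ` X)"
proof -
  have "mat_mult R x v = mat_zero R 1 1 \<longleftrightarrow> dot n (transpose_mat x) v = \<zero>"
    if "x \<in> X" "v \<in> mats R n 1" for x v
    unfolding mat_mult_row_col[OF subsetD[OF assms that(1)] that(2)]
      by (auto simp: mat_zero_def mat_eq_iff)
  then show ?thesis by (auto simp: orth_compl_def perp_def)
qed

text \<open>
  The rows of \<open>A\<close> lie in \<open>Row(A)\<close>, so that vectors orthogonal to \<open>Row(A)\<close> are annihilated by \<open>A\<close>.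
\<close>

lemma row_mem_Row:
  assumes A: "A \<in> mats R m n" and i: "i < m"
  shows "mat 1 n (\<lambda>(_, j). A $$ (i,j)) \<in> Row R A"
proof -
  define u where "u = mat 1 m (\<lambda>(_, k). if i = k then \<one> else \<zero>)"
  have "u \<in> mats R 1 (dim_row A)" using A by (simp add: u_def mats_mat mats_dim)
  moreover have "mat_mult R u A = mat 1 n (\<lambda>(_, j). A $$ (i,j))"
  proof (rule eq_matI)
    fix k j assume "k < dim_row (mat 1 n (\<lambda>(_, j). A $$ (i,j)))" "j < dim_col (mat 1 n (\<lambda>(_, j). A $$ (i,j)))"
    then have j: "k = 0" "j < n" by auto
    have "(\<Oplus>k\<in>{..<m}. u $$ (0,k) \<otimes> A $$ (k,j)) = (\<Oplus>k\<in>{..<m}. if i = k then A $$ (k,j) else \<zero>)"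
      using j matsD[OF A] by (intro add.finprod_cong') (auto simp: u_def)
    also have "\<dots> = A $$ (i,j)"
      using add.finprod_singleton[of i "{..<m}" "\<lambda>k. A $$ (k,j)"] i j matsD[OF A] by auto
    finally show "mat_mult R u A $$ (k,j) = mat 1 n (\<lambda>(_, j). A $$ (i,j)) $$ (k,j)"
      using j A by (simp add: mat_mult_def mats_dim u_def)
  qed (use A in \<open>auto simp: mat_mult_def mats_dim u_def\<close>)
  ultimately show ?thesis unfolding Row_def by force
qed

lemma mat_mult_orth_compl:
  assumes A: "A \<in> mats R m n" and v: "v \<in> orth_compl R n (Row R A)"
  shows "mat_mult R A v = mat_zero R m 1"
proof (rule eq_matI)
  have vc: "v \<in> mats R n 1" using v by (simp add: orth_compl_def)
  fix i j assume "i < dim_row (mat_zero R m 1)" "j < dim_col (mat_zero R m 1)"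
  then have ij: "i < m" "j = 0" by (auto simp: mat_zero_def)
  have "(\<Oplus>k\<in>{..<n}. A $$ (i,k) \<otimes> v $$ (k,0)) =
      (\<Oplus>k\<in>{..<n}. mat 1 n (\<lambda>(_, j). A $$ (i,j)) $$ (0,k) \<otimes> v $$ (k,0))"
    using ij matsD[OF A] matsD[OF vc] by (intro add.finprod_cong') auto
  also have "\<dots> = mat_mult R (mat 1 n (\<lambda>(_, j). A $$ (i,j))) v $$ (0,0)"
    using vc by (simp add: mat_mult_def mats_dim)
  also have "\<dots> = \<zero>" using v row_mem_Row[OF A ij(1)] by (simp add: orth_compl_def mat_zero_def)
  finally show "mat_mult R A v $$ (i,j) = mat_zero R m 1 $$ (i,j)"
    using ij A vc by (simp add: mat_mult_def mats_dim mat_zero_def)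
qed (use A v in \<open>auto simp: orth_compl_def mat_mult_def mats_dim mat_zero_def\<close>)

lemma mat_mult_zero:
  assumes A: "A \<in> mats R m n"
  shows "mat_mult R A (mat_zero R n l) = mat_zero R m l"
proof (rule eq_matI)
  fix i j assume "i < dim_row (mat_zero R m l)" "j < dim_col (mat_zero R m l)"
  then have ij: "i < m" "j < l" by (auto simp: mat_zero_def)
  have "(\<Oplus>k\<in>{..<n}. A $$ (i,k) \<otimes> mat_zero R n l $$ (k,j)) = \<zero>"
    using ij matsD[OF A] by (intro add.finprod_one_eqI) (simp add: mat_zero_def)
  then show "mat_mult R A (mat_zero R n l) $$ (i,j) = mat_zero R m l $$ (i,j)"
    using ij A by (simp add: mat_mult_def mats_dim mat_zero_def)
qed (use A in \<open>auto simp: mat_mult_def mats_dim mat_zero_def\<close>)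

lemma dot_unit:
  assumes x: "x \<in> mats R n 1" and i: "i < n"
  shows "dot n x (mat n 1 (\<lambda>(k, _). if i = k then \<one> else \<zero>)) = x $$ (i,0)"
proof -
  have "dot n x (mat n 1 (\<lambda>(k, _). if i = k then \<one> else \<zero>)) = (\<Oplus>k\<in>{..<n}. if i = k then x $$ (k,0) else \<zero>)"
    unfolding dot_def using matsD[OF x] by (intro add.finprod_cong') auto
  also have "\<dots> = x $$ (i,0)"
    using add.finprod_singleton[of i "{..<n}" "\<lambda>k. x $$ (k,0)"] i matsD[OF x] by auto
  finally show ?thesis .
qed

end

context self_dual_pir
begin

lemma Row_duality:
  assumes A: "A \<in> mats R m n"
  obtains \<sigma> where "duality_map n (transpose_mat ` Row R A) \<sigma>"
  using duality_map_exists linear_on_image_submodule[OF mat_module_module mat_module_module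
      transpose_linear Row_submodule[OF A]] by blast

theorem Row_perp_isomorphic:
  assumes A: "A \<in> mats R m n"
  shows "module_isomorphic R
         ((mat_module R n 1)\<lparr>carrier := orth_compl R n (Row R A)\<rparr>)
         (quotient_module (mat_module R 1 n) (Row R A))"
proof -
  obtain \<sigma> where \<sigma>: "duality_map n (transpose_mat ` Row R A) \<sigma>" using Row_duality[OF A] .
  have lin: "linear_on R (colvec n) (colvec n) \<sigma>"
    and ker: "\<And>x. x \<in> mats R n 1 \<Longrightarrow> \<sigma> x = mat_zero R n 1 \<longleftrightarrow> x \<in> transpose_mat ` Row R A"
    and im: "\<sigma> ` mats R n 1 = orth_compl R n (Row R A)"
    using \<sigma> orth_compl_eq_perp[OF Row_subset[OF A]] unfolding duality_map_def by blast+
  have "transpose_mat ` mats R 1 n = mats R n 1"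
    using transpose_mats by (force simp: image_iff intro: transpose_transpose[symmetric])
  then have K: "orth_compl R n (Row R A) = (\<lambda>x. \<sigma> (transpose_mat x)) ` mats R 1 n"
    unfolding im[symmetric] by (metis image_image)
  show ?thesis
  proof (rule image_isomorphic_quotient[OF mat_module_module mat_module_module
        linear_on_comp[OF transpose_linear lin] Row_submodule[OF A]])
    fix x assume "x \<in> carrier (mat_module R 1 n)"
    then have "x \<in> mats R 1 n" by (simp only: mat_module_simps)
    from ker[OF transpose_mats[OF this]]
    show "\<sigma> (transpose_mat x) = \<zero>\<^bsub>colvec n\<^esub> \<longleftrightarrow> x \<in> Row R A"
      by (simp only: mat_module_simps transpose_image_iff)
  qed (simp only: mat_module_simps K)
qed

text \<open>
  The vector separating \<open>x\<close> from \<open>Row(A)\<close> is \<open>\<sigma> e\<^sub>i\<close>, where the coordinate \<open>i\<close> of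
  \<open>\<sigma> x\<close> is nonzero; it is compared with the zero vector.
\<close>

lemma Row_separation:
  assumes A: "A \<in> mats R m n" and x: "x \<in> mats R 1 n - Row R A"
  shows "\<exists>v \<in> mats R n 1. \<exists>v' \<in> mats R n 1.
           mat_mult R A v = mat_mult R A v' \<and> mat_mult R x v \<noteq> mat_mult R x v'"
proof -
  obtain \<sigma> where \<sigma>: "duality_map n (transpose_mat ` Row R A) \<sigma>" using Row_duality[OF A] .
  have lin: "linear_on R (colvec n) (colvec n) \<sigma>"
    and sym: "\<And>x y. x \<in> mats R n 1 \<Longrightarrow> y \<in> mats R n 1 \<Longrightarrow> dot n (\<sigma> x) y = dot n x (\<sigma> y)"
    and ker: "\<And>x. x \<in> mats R n 1 \<Longrightarrow> \<sigma> x = mat_zero R n 1 \<longleftrightarrow> x \<in> transpose_mat ` Row R A"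
    and im: "\<sigma> ` mats R n 1 = orth_compl R n (Row R A)"
    using \<sigma> orth_compl_eq_perp[OF Row_subset[OF A]] unfolding duality_map_def by blast+
  have xc: "x \<in> mats R 1 n" "x \<notin> Row R A" using x by auto
  note xt = transpose_mats[OF xc(1)]
  have sc: "\<sigma> (transpose_mat x) \<in> mats R n 1"
    using linear_onD(1)[OF lin] xt by (simp add: mat_module_simps)
  have "\<sigma> (transpose_mat x) \<noteq> mat_zero R n 1"
    using ker[OF xt] xc(2) transpose_image_iff by blast
  then obtain i where i: "i < n" "\<sigma> (transpose_mat x) $$ (i,0) \<noteq> \<zero>"
    using col_eqI[OF sc zero_mats] by (auto simp: mat_zero_def)
  define e where "e = mat n 1 (\<lambda>(k, _). if i = k then \<one> else \<zero>)"
  have e: "e \<in> mats R n 1" by (simp add: e_def mats_mat)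
  have v: "\<sigma> e \<in> orth_compl R n (Row R A)" using im e by blast
  then have vc: "\<sigma> e \<in> mats R n 1" by (simp add: orth_compl_def)
  have "dot n (transpose_mat x) (\<sigma> e) = \<sigma> (transpose_mat x) $$ (i,0)"
    using sym[OF xt e] dot_unit[OF sc i(1)] by (simp add: e_def)
  then have "mat_mult R x (\<sigma> e) \<noteq> mat_zero R 1 1"
    using i(2) by (auto simp: mat_mult_row_col[OF xc(1) vc] mat_zero_def mat_eq_iff)
  then show ?thesis
    using vc zero_mats mat_mult_orth_compl[OF A v] mat_mult_zero[OF A] mat_mult_zero[OF xc(1)]
      by metis
qed

lemma Col_separation:
  assumes A: "A \<in> mats R m n" and y: "y \<in> mats R m 1 - Col R A"
  shows "\<exists>u \<in> mats R 1 m. \<exists>u' \<in> mats R 1 m.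
           mat_mult R u A = mat_mult R u' A \<and> mat_mult R u y \<noteq> mat_mult R u' y"
proof -
  have yc: "y \<in> mats R m 1" using y by blast
  have "transpose_mat y \<notin> Row R (transpose_mat A)"
  proof
    assume "transpose_mat y \<in> Row R (transpose_mat A)"
    then obtain u where u: "u \<in> mats R 1 n" "transpose_mat y = mat_mult R u (transpose_mat A)"
      using A by (auto simp: Row_def mats_dim)
    have "y = mat_mult R A (transpose_mat u)"
      using transpose_mat_mult[OF u(1) transpose_mats[OF A]] u(2) by (metis transpose_transpose)
    then have "y \<in> Col R A" using transpose_mats[OF u(1)] A by (auto simp: Col_def mats_dim)
    then show False using y by blast
  qed
  then have "transpose_mat y \<in> mats R 1 m - Row R (transpose_mat A)"
    using transpose_mats[OF yc] by blast
  from Row_separation[OF transpose_mats[OF A] this] obtain v v' where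
    v: "v \<in> mats R m 1" "v' \<in> mats R m 1"
      "mat_mult R (transpose_mat A) v = mat_mult R (transpose_mat A) v'"
      "mat_mult R (transpose_mat y) v \<noteq> mat_mult R (transpose_mat y) v'" by blast
  have tr: "mat_mult R (transpose_mat w) B = transpose_mat (mat_mult R (transpose_mat B) w)"
    if "w \<in> mats R m 1" "B \<in> mats R m l" for w B l
    using transpose_mat_mult[OF transpose_mats[OF that(2)] that(1)] by simp
  have "mat_mult R (transpose_mat v) A = mat_mult R (transpose_mat v') A"
    using tr[OF v(1) A] tr[OF v(2) A] v(3) by simp
  moreover have "mat_mult R (transpose_mat v) y \<noteq> mat_mult R (transpose_mat v') y"
    using tr[OF v(1) yc] tr[OF v(2) yc] v(4) by (metis transpose_transpose)
  ultimately show ?thesis using transpose_mats[OF v(1)] transpose_mats[OF v(2)] by blast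
qed

theorem exact: "exact_ring R"
  unfolding exact_ring_def using Row_separation Col_separation by blast

end

theorem corollary4p5:
  fixes P :: "('a, 'b) ring_scheme" and r :: 'a and R :: "'a set ring"
  assumes "principal_domain P"
    and "r \<in> carrier P - {\<zero>\<^bsub>P\<^esub>}"
    and "R = P Quot (PIdl\<^bsub>P\<^esub> r)"
  shows "exact_ring R \<and>
    (\<forall>m > 0. \<forall>n > 0. \<forall>A \<in> mats R m n.
       module_isomorphic R
         ((mat_module R n 1)\<lparr>carrier := orth_compl R n (Row R A)\<rparr>)
         (quotient_module (mat_module R 1 n) (Row R A)))"
proof -
  interpret self_dual_pir R
    unfolding assms(3) using assms(1,2) by (intro principal_domain.quotient_self_dual_pir) auto
  show ?thesis using exact Row_perp_isomorphic by blast
qed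

end
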